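(* Let $A$ be a real $n$-by-$n$ matrix with singular values $\sigma_1\ge\cdots\ge\sigma_n$ and let $1\le r<n$. In exact arithmetic, the matrix $R$ produced by $[U,R,V]=RURV(A)$ satisfies the following two conditions, where $f$ is a random variable equal to the smallest singular value of an $r$-by-$r$ submatrix of a (Haar distributed) random $n$-by-$n$ orthogonal matrix. First, $$ f\cdot\sigma_r\;\le\;\sigma_{\min}(R(1:r,1:r))\;\le\;\sqrt{\sigma_r^2+\sigma_{r+1}^2}\;\le\;\sqrt2\cdot\sigma_r . $$ Second, assuming $\sigma_{r+1}<f\sigma_r$, $$ \sigma_{r+1}\;\le\;\sigma_{\max}(R(r+1:n,r+1:n))\;\le\;3\,\sigma_{r+1}\cdot\frac{f^{-4}\left(\frac{\sigma_1}{\sigma_r}\right)^3}{1-\frac{\sigma_{r+1}^2}{f^2\sigma_r^2}} . $$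
   Context: $\sigma_{\min}$ and $\sigma_{\max}$ denote smallest and largest singular values, and $R(i:j,k:l)$ denotes the submatrix of rows $i,\dots,j$ and columns $k,\dots,l$. The algorithm $[U,R,V]=RURV(A)$ for a real $n$-by-$n$ matrix $A$: generate a random $n$-by-$n$ matrix $B$ with independent standard Gaussian $N(0,1)$ entries; compute a QR decomposition of $B$ and let $V$ be its orthogonal factor, so that $V$ is a Haar distributed random $n$-by-$n$ orthogonal matrix (uniform over the orthogonal group); form $\hat A=A\cdot V^T$; compute a QR decomposition $\hat A=U\cdot R$ with $U$ orthogonal and $R$ upper triangular. Thus $A=U\cdot R\cdot V$. The random variable $f$ is defined on the same probability space as $V$ and is the same in both conditions. *)

theory Defs
  imports
    "HOL-Probability.Probability"
    "Jordan_Normal_Form.Char_Poly"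
    "Jordan_Normal_Form.DL_Submatrix"
begin

text \<open>Square real matrices are elements of \<^term>\<open>carrier_mat n n :: real mat set\<close>; their indices
  start at 0.\<close>

section \<open>Singular values\<close>

text \<open>The nonnegative square roots of the eigenvalues of \<open>A\<^sup>T A\<close>, counted with algebraic
  multiplicity and listed in decreasing order. Only used for square \<open>A\<close>: for a matrix with more
  columns than rows the list would contain surplus zeros.\<close>

definition singular_values :: "real mat \<Rightarrow> real list" where
  "singular_values A =
     rev (sorted_list_of_multiset (image_mset sqrt (proots (char_poly (transpose_mat A * A)))))"

text \<open>The numbering of singular values starts at 1: \<open>sing_val A 1\<close> is the largest one.\<close>

definition sing_val :: "real mat \<Rightarrow> nat \<Rightarrow> real" where
  "sing_val A k = singular_values A ! (k - 1)"

definition sigma_max :: "real mat \<Rightarrow> real" where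
  "sigma_max A = Max (set (singular_values A))"

definition sigma_min :: "real mat \<Rightarrow> real" where
  "sigma_min A = Min (set (singular_values A))"

section \<open>QR decompositions\<close>

text \<open>The library's \<^const>\<open>orthogonal_mat\<close> only asks for nonzero, pairwise orthogonal columns, so
  it is not used here.\<close>

definition orthogonal_group :: "nat \<Rightarrow> real mat set" where
  "orthogonal_group n = {Q \<in> carrier_mat n n. transpose_mat Q * Q = 1\<^sub>m n}"

definition qr_decomposition :: "nat \<Rightarrow> real mat \<Rightarrow> real mat \<Rightarrow> real mat \<Rightarrow> bool" where
  "qr_decomposition n A Q R \<longleftrightarrow>
     Q \<in> orthogonal_group n \<and> R \<in> carrier_mat n n \<and> upper_triangular R \<and> A = Q * R"

section \<open>Random matrices\<close>

definition random_matrix :: "'w measure \<Rightarrow> nat \<Rightarrow> ('w \<Rightarrow> real mat) \<Rightarrow> bool" where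
  "random_matrix M n X \<longleftrightarrow>
     (\<forall>\<omega>\<in>space M. X \<omega> \<in> carrier_mat n n) \<and>
     (\<forall>i<n. \<forall>j<n. (\<lambda>\<omega>. X \<omega> $$ (i, j)) \<in> borel_measurable M)"

definition gaussian_matrix :: "'w measure \<Rightarrow> nat \<Rightarrow> ('w \<Rightarrow> real mat) \<Rightarrow> bool" where
  "gaussian_matrix M n B \<longleftrightarrow>
     random_matrix M n B \<and>
     prob_space.indep_vars M (\<lambda>_. borel) (\<lambda>ij \<omega>. B \<omega> $$ ij) ({..<n} \<times> {..<n}) \<and>
     (\<forall>i<n. \<forall>j<n. distributed M lborel (\<lambda>\<omega>. B \<omega> $$ (i, j)) std_normal_density)"

text \<open>The joint distribution of the entries.\<close>

definition matrix_law :: "'w measure \<Rightarrow> nat \<Rightarrow> ('w \<Rightarrow> real mat) \<Rightarrow> (nat \<times> nat \<Rightarrow> real) measure" where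
  "matrix_law M n X =
     distr M (\<Pi>\<^sub>M ij\<in>{..<n} \<times> {..<n}. borel) (\<lambda>\<omega>. \<lambda>ij\<in>{..<n} \<times> {..<n}. X \<omega> $$ ij)"

text \<open>The law of a Haar distributed matrix is the probability measure on the orthogonal group that
  is invariant under left translations. As the group is compact, this measure is unique and is
  invariant under right translations as well.\<close>

definition haar_orthogonal :: "'w measure \<Rightarrow> nat \<Rightarrow> ('w \<Rightarrow> real mat) \<Rightarrow> bool" where
  "haar_orthogonal M n X \<longleftrightarrow>
     random_matrix M n X \<and>
     (\<forall>\<omega>\<in>space M. X \<omega> \<in> orthogonal_group n) \<and>
     (\<forall>Q\<in>orthogonal_group n. matrix_law M n (\<lambda>\<omega>. Q * X \<omega>) = matrix_law M n X)"

section \<open>The algorithm RURV\<close>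

text \<open>\<open>rurv M n A B U R V\<close>: on the probability space \<open>M\<close>, \<open>(U, R, V)\<close> is an output of the algorithm
  on input \<open>A\<close>, where \<open>B\<close> is the Gaussian matrix it generates.

  The orthogonal factor of \<open>B\<close> is Haar distributed only for a suitable normalisation of the QR
  decomposition (one may multiply the columns of \<open>V\<close> and the rows of \<open>T\<close> by arbitrary signs). The
  usual one, a nonnegative diagonal of the triangular factor, is imposed on \<open>B = V * T\<close>; \<open>V\<close> is then
  almost surely unique. The second QR decomposition is arbitrary.\<close>

definition rurv :: "'w measure \<Rightarrow> nat \<Rightarrow> real mat \<Rightarrow> ('w \<Rightarrow> real mat) \<Rightarrow>
    ('w \<Rightarrow> real mat) \<Rightarrow> ('w \<Rightarrow> real mat) \<Rightarrow> ('w \<Rightarrow> real mat) \<Rightarrow> bool" where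
  "rurv M n A B U R V \<longleftrightarrow>
     gaussian_matrix M n B \<and> random_matrix M n V \<and>
     (\<forall>\<omega>\<in>space M.
        (\<exists>T. qr_decomposition n (B \<omega>) (V \<omega>) T \<and> (\<forall>i<n. 0 \<le> T $$ (i, i))) \<and>
        qr_decomposition n (A * transpose_mat (V \<omega>)) (U \<omega>) (R \<omega>))"

end

theory Submission
  imports Defs "Jordan_Normal_Form.Schur_Decomposition" "Jordan_Normal_Form.Spectral_Radius"
begin

text \<open>Let \<open>Q\<close> be an orthogonal matrix whose columns are eigenvectors of \<open>A\<^sup>T A\<close>, in the order of decreasing
eigenvalues \<open>\<sigma>\<^sub>i\<^sup>2\<close>, and put \<open>X = V Q\<close>. Since \<open>A V\<^sup>T = U R\<close> with \<open>U\<close> orthogonal,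
\<open>|R w|\<^sup>2 = |A V\<^sup>T w|\<^sup>2\<close> is the sum of the terms \<open>\<sigma>\<^sub>i\<^sup>2 ((X\<^sup>T w)\<^sub>i)\<^sup>2\<close> for every vector \<open>w\<close>. All bounds are
read off from this identity, and \<open>f\<close> is the smallest singular value of the leading \<open>r \<times> r\<close> block
\<open>X11\<close> of \<open>X\<close>, which is also that of its transpose (\<open>bounded_below_transpose\<close>).

Deterministic part (\<open>rurv_singular_value_bounds\<close>). As \<open>R\<close> is upper triangular, vectors \<open>(y, 0)\<close> probe
\<open>R11\<close>: the first \<open>r\<close> coordinates of \<open>X\<^sup>T (y, 0)\<close> are \<open>X11\<^sup>T y\<close>, which gives \<open>f \<sigma>\<^sub>r \<le> \<sigma>\<^sub>m\<^sub>i\<^sub>n(R11)\<close>.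
Counting dimensions gives test vectors for \<open>\<sigma>\<^sub>m\<^sub>i\<^sub>n(R11) \<le> \<sigma>\<^sub>r\<close> and \<open>\<sigma>\<^sub>r\<^sub>+\<^sub>1 \<le> \<sigma>\<^sub>m\<^sub>a\<^sub>x(R22)\<close>. For the upper
bound on \<open>R22\<close>, extend \<open>x\<close> to \<open>(y, x)\<close> such that the first \<open>r\<close> coordinates of \<open>X\<^sup>T (y, x)\<close> vanish; this
is possible when \<open>f > 0\<close>, and costs at most a factor \<open>\<surd>2 / f\<close> in length. The resulting bound
\<open>\<surd>2 \<sigma>\<^sub>r\<^sub>+\<^sub>1 / f\<close> is stronger than the asserted one, since \<open>f \<le> 1\<close> and \<open>\<sigma>\<^sub>1 \<ge> \<sigma>\<^sub>r\<close>
(\<open>crude_factor_bound\<close>).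

Probabilistic part (\<open>haar_orthogonal_gaussian_qr_mult_right\<close>). The law of a Gaussian matrix \<open>B\<close> is
invariant under \<open>B \<mapsto> P B\<close> for orthogonal \<open>P\<close> (\<open>gaussian_matrix_law_orthogonal_invariant\<close>). Almost
surely \<open>B\<close> is invertible, and then its orthogonal factor is the result of the Gram-Schmidt process, so
that the factor of \<open>P B\<close> is \<open>P V\<close>; hence the law of \<open>V\<close> is invariant under left translations
(\<open>gaussian_qr_left_invariant\<close>). Multiplication by the fixed matrix \<open>Q\<close> on the right preserves this
property, so \<open>X\<close> is Haar distributed. Finally \<open>f\<close> is measurable because \<open>c \<le> \<sigma>\<^sub>m\<^sub>i\<^sub>n(N)\<close> for \<open>c > 0\<close>
amounts to the countably many inequalities \<open>c\<^sup>2 |x|\<^sup>2 \<le> |N x|\<^sup>2\<close> with integer vectors \<open>x\<close>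
(\<open>sigma_min_measurable\<close>).\<close>

text \<open>Below, both symbols refer to the vectors over which matrices with explicit dimensions act.\<close>

no_notation inner (infix "\<bullet>" 70)
no_notation vec_nth (infixl "$" 90)

section \<open>Orthogonal matrices and Euclidean norms\<close>

lemma orthogonal_groupD:
  assumes "Q \<in> orthogonal_group n"
  shows "Q \<in> carrier_mat n n" "transpose_mat Q * Q = 1\<^sub>m n" "Q * transpose_mat Q = 1\<^sub>m n"
proof -
  show Q: "Q \<in> carrier_mat n n" and 1: "transpose_mat Q * Q = 1\<^sub>m n"
    using assms by (auto simp: orthogonal_group_def)
  show "Q * transpose_mat Q = 1\<^sub>m n"
    by (rule mat_mult_left_right_inverse[OF _ Q 1]) (use Q in auto)
qed

lemma orthogonal_group_transpose:
  assumes "Q \<in> orthogonal_group n"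
  shows "transpose_mat Q \<in> orthogonal_group n"
  using orthogonal_groupD(1,3)[OF assms] by (simp add: orthogonal_group_def)

lemma orthogonal_group_mult:
  assumes "P \<in> orthogonal_group n" "Q \<in> orthogonal_group n"
  shows "P * Q \<in> orthogonal_group n"
proof -
  note P = orthogonal_groupD[OF assms(1)] and Q = orthogonal_groupD[OF assms(2)]
  have "transpose_mat (P * Q) * (P * Q) = transpose_mat Q * (transpose_mat P * P) * Q"
    using P(1) Q(1) by (simp add: transpose_mult[of _ n n _ n] assoc_mult_mat[of _ n n _ n _ n])
  also have "\<dots> = 1\<^sub>m n" using P Q by simp
  finally show ?thesis using P Q by (auto simp: orthogonal_group_def)
qed

lemma orthogonal_group_sq_norm:
  assumes Q: "Q \<in> orthogonal_group n" and x: "x \<in> carrier_vec n"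
  shows "(Q *\<^sub>v x) \<bullet> (Q *\<^sub>v x) = x \<bullet> x"
proof -
  note Q' = orthogonal_groupD[OF Q]
  have "(Q *\<^sub>v x) \<bullet> (Q *\<^sub>v x) = (transpose_mat Q *\<^sub>v (Q *\<^sub>v x)) \<bullet> x"
    by (rule transpose_vec_mult_scalar[symmetric]) (use Q' x in auto)
  also have "transpose_mat Q *\<^sub>v (Q *\<^sub>v x) = x"
    using Q' x by (simp flip: assoc_mult_mat_vec[of _ n n _ n])
  finally show ?thesis .
qed

lemma sq_norm_sum: "x \<in> carrier_vec n \<Longrightarrow> x \<bullet> x = (\<Sum>i<n. (x $ i :: real)\<^sup>2)"
  by (auto simp: scalar_prod_def power2_eq_square lessThan_atLeast0)

lemma sq_norm_nonneg: "(x :: real vec) \<bullet> x \<ge> 0"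
  by (auto simp: scalar_prod_def intro!: sum_nonneg)

lemma sq_norm_eq_0_iff: 
  assumes "(x :: real vec) \<in> carrier_vec n" shows "x \<bullet> x = 0 \<longleftrightarrow> x = 0\<^sub>v n"
proof
  assume "x \<bullet> x = 0"
  then have "(\<Sum>i<n. (x $ i)\<^sup>2) = 0" using sq_norm_sum[OF assms] by simp
  then have "\<forall>i<n. x $ i = 0" by (subst (asm) sum_nonneg_eq_0_iff) auto
  then show "x = 0\<^sub>v n" using assms by auto
qed (use assms in auto)

section \<open>Diagonalisation of real symmetric matrices\<close>

text \<open>Let \<open>x + i y\<close> be a complex eigenvector for the eigenvalue \<open>a + i b\<close>. Comparing real and imaginary parts
gives \<open>G x = a x - b y\<close> and \<open>G y = b x + a y\<close>, and then \<open>(G x) \<bullet> y = x \<bullet> (G y)\<close> reads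
\<open>b (x \<bullet> x + y \<bullet> y) = 0\<close>. Hence \<open>b = 0\<close>, and whichever of \<open>x\<close> and \<open>y\<close> is nonzero is a real
eigenvector.\<close>

lemma symmetric_mat_has_eigenvector:
  fixes G :: "real mat"
  assumes G: "G \<in> carrier_mat n n" and sym: "transpose_mat G = G" and n: "0 < n"
  obtains e v where "v \<in> carrier_vec n" "v \<noteq> 0\<^sub>v n" "G *\<^sub>v v = e \<cdot>\<^sub>v v"
proof -
  let ?C = "map_mat complex_of_real G"
  have C: "?C \<in> carrier_mat n n" using G by auto
  obtain l z where "eigenvector ?C z l"
    using spectrum_non_empty[OF C n] by (auto simp: spectrum_def eigenvalue_def)
  then have z: "z \<in> carrier_vec n" "z \<noteq> 0\<^sub>v n" and ev: "?C *\<^sub>v z = l \<cdot>\<^sub>v z"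
    using G by (auto simp: eigenvector_def)
  define x y where "x = map_vec Re z" and "y = map_vec Im z"
  define a b where "a = Re l" and "b = Im l"
  have x: "x \<in> carrier_vec n" and y: "y \<in> carrier_vec n" using z by (auto simp: x_def y_def)
  have entry: "(\<Sum>j<n. complex_of_real (G $$ (i,j)) * z $ j) = l * z $ i" if "i < n" for i
  proof -
    have "(?C *\<^sub>v z) $ i = (l \<cdot>\<^sub>v z) $ i" using ev by simp
    then show ?thesis using that G z by (simp add: scalar_prod_def lessThan_atLeast0)
  qed
  have Gx: "G *\<^sub>v x = a \<cdot>\<^sub>v x - b \<cdot>\<^sub>v y"
  proof (rule eq_vecI)
    fix i assume "i < dim_vec (a \<cdot>\<^sub>v x - b \<cdot>\<^sub>v y)"
    then have i: "i < n" using y by auto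
    show "(G *\<^sub>v x) $ i = (a \<cdot>\<^sub>v x - b \<cdot>\<^sub>v y) $ i"
      using arg_cong[OF entry[OF i], of Re] i G z
      by (simp add: scalar_prod_def lessThan_atLeast0 x_def y_def a_def b_def)
  qed (use G y in auto)
  have Gy: "G *\<^sub>v y = b \<cdot>\<^sub>v x + a \<cdot>\<^sub>v y"
  proof (rule eq_vecI)
    fix i assume "i < dim_vec (b \<cdot>\<^sub>v x + a \<cdot>\<^sub>v y)"
    then have i: "i < n" using y by auto
    show "(G *\<^sub>v y) $ i = (b \<cdot>\<^sub>v x + a \<cdot>\<^sub>v y) $ i"
      using arg_cong[OF entry[OF i], of Im] i G z
      by (simp add: scalar_prod_def lessThan_atLeast0 x_def y_def a_def b_def)
  qed (use G y in auto)
  have "(G *\<^sub>v x) \<bullet> y = x \<bullet> (G *\<^sub>v y)"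
    using transpose_vec_mult_scalar[OF G y x] sym by simp
  then have "a * (x \<bullet> y) - b * (y \<bullet> y) = b * (x \<bullet> x) + a * (x \<bullet> y)"
    unfolding Gx Gy using x y
    by (simp add: minus_scalar_prod_distrib[of _ n] scalar_prod_add_distrib[of _ n])
  then have b0: "b * (x \<bullet> x + y \<bullet> y) = 0" by (simp add: algebra_simps)
  have ne: "x \<noteq> 0\<^sub>v n \<or> y \<noteq> 0\<^sub>v n"
  proof (rule ccontr)
    assume "\<not> ?thesis"
    then have "z $ i = 0" if "i < n" for i
    proof -
      have "x $ i = 0" "y $ i = 0" using \<open>\<not> (x \<noteq> 0\<^sub>v n \<or> y \<noteq> 0\<^sub>v n)\<close> that by auto
      then show ?thesis using that z by (simp add: x_def y_def complex_eq_iff)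
    qed
    then show False using z by auto
  qed
  have "x \<bullet> x + y \<bullet> y \<noteq> 0"
    using ne sq_norm_eq_0_iff[OF x] sq_norm_eq_0_iff[OF y] sq_norm_nonneg[of x] sq_norm_nonneg[of y]
    by auto
  with b0 have "b = 0" by simp
  then have "G *\<^sub>v x = a \<cdot>\<^sub>v x" "G *\<^sub>v y = a \<cdot>\<^sub>v y" using Gx Gy x y by auto
  with ne that x y show thesis by blast
qed

text \<open>Gram-Schmidt applied to a basis that starts with \<open>v\<close> leaves \<open>v\<close> in place; the resulting orthogonal
vectors only have to be normalised.\<close>

lemma orthogonal_completion:
  fixes v :: "real vec"
  assumes v: "v \<in> carrier_vec n" "v \<noteq> 0\<^sub>v n"
  obtains W where "W \<in> orthogonal_group n" "col W 0 = (1 / sqrt (v \<bullet> v)) \<cdot>\<^sub>v v"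
proof -
  have n: "n \<noteq> 0" using v by (metis carrier_vecD eq_vecI index_zero_vec(2) less_nat_zero_code)
  interpret cof_vec_space n "TYPE(real)" .
  define b where "b = basis_completion v"
  define ws where "ws = gram_schmidt n b"
  from basis_completion[OF v, folded b_def]
  have dist_b: "distinct b" and indep: "\<not> lin_dep (set b)" and b: "set b \<subseteq> carrier_vec n"
    and hdb: "hd b = v" and len_b: "length b = n" by auto
  from hdb len_b n obtain vs where bv: "b = v # vs" by (cases b, auto)
  from gram_schmidt_result[OF b dist_b indep refl, folded ws_def]
  have ws: "set ws \<subseteq> carrier_vec n" "corthogonal ws" "length ws = n" by (auto simp: len_b)
  from gram_schmidt_hd[OF v(1), of vs, folded bv] have "hd ws = v" unfolding ws_def .
  then have ws0: "ws ! 0 = v" using ws n by (cases ws) auto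
  have wsc: "ws ! i \<in> carrier_vec n" if "i < n" for i using ws that by auto
  have orth: "ws ! i \<bullet> ws ! j = 0 \<longleftrightarrow> i \<noteq> j" if "i < n" "j < n" for i j
    using corthogonalD[OF ws(2), of i j] ws that by (simp add: conjugate_vec_def)
  define us where "us i = (1 / sqrt (ws ! i \<bullet> ws ! i)) \<cdot>\<^sub>v ws ! i" for i
  have us: "us i \<in> carrier_vec n" if "i < n" for i using wsc[OF that] by (auto simp: us_def)
  have "us i \<bullet> us j = (if i = j then 1 else 0)" if "i < n" "j < n" for i j
    using orth[OF that] wsc[OF that(1)] wsc[OF that(2)] sq_norm_nonneg[of "ws ! i"]
    by (auto simp: us_def)
  moreover define W where "W = mat_of_cols n (map us [0..<n])"
  have W: "W \<in> carrier_mat n n" by (auto simp: W_def)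
  moreover have col: "col W i = us i" if "i < n" for i using that us by (auto simp: W_def)
  ultimately have "transpose_mat W * W = 1\<^sub>m n" by (intro eq_matI) auto
  then have "W \<in> orthogonal_group n" using W by (auto simp: orthogonal_group_def)
  then show thesis using that col[of 0] n ws0 by (auto simp: us_def)
qed

text \<open>Deflation: in an orthonormal basis that starts with an eigenvector, the first column of \<open>G\<close> is a
multiple of the first unit vector, hence so is its first row by symmetry, and the induction
hypothesis applies to the remaining block.\<close>

lemma symmetric_mat_diagonalization:
  fixes G :: "real mat"
  assumes "G \<in> carrier_mat n n" "transpose_mat G = G"
  obtains Q where "Q \<in> orthogonal_group n" "diagonal_mat (transpose_mat Q * G * Q)"
  using assms
proof (induction n arbitrary: G thesis)
  case 0
  then show ?case
    by (intro "0.prems"(1)[of "1\<^sub>m 0"]) (auto simp: orthogonal_group_def diagonal_mat_def)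
next
  case (Suc n)
  note G = Suc.prems(2) and sym = Suc.prems(3)
  obtain e v where v: "v \<in> carrier_vec (Suc n)" "v \<noteq> 0\<^sub>v (Suc n)" "G *\<^sub>v v = e \<cdot>\<^sub>v v"
    using symmetric_mat_has_eigenvector[OF G sym] by blast
  obtain W where W: "W \<in> orthogonal_group (Suc n)" and W0: "col W 0 = (1 / sqrt (v \<bullet> v)) \<cdot>\<^sub>v v"
    using orthogonal_completion[OF v(1,2)] by auto
  note W' = orthogonal_groupD[OF W]
  define H where "H = transpose_mat W * G * W"
  have H: "H \<in> carrier_mat (Suc n) (Suc n)" using W' G by (auto simp: H_def)
  have Hsym: "transpose_mat H = H" using W' G sym
    by (simp add: H_def transpose_mult[of _ "Suc n" "Suc n" _ "Suc n"] assoc_mult_mat[of _ "Suc n" "Suc n" _ "Suc n" _ "Suc n"])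
  have "col H 0 = (transpose_mat W * G) *\<^sub>v col W 0"
    unfolding H_def by (rule col_mult2) (use W' G in auto)
  also have "\<dots> = transpose_mat W *\<^sub>v (G *\<^sub>v col W 0)"
    by (rule assoc_mult_mat_vec) (use W' G in \<open>auto intro: col_carrier_vec\<close>)
  also have "G *\<^sub>v col W 0 = e \<cdot>\<^sub>v col W 0"
    using v G by (simp add: W0 mult_mat_vec[of _ "Suc n" "Suc n"] smult_smult_assoc mult.commute)
  also have "transpose_mat W *\<^sub>v (e \<cdot>\<^sub>v col W 0) = e \<cdot>\<^sub>v col (transpose_mat W * W) 0"
    using W'(1) by (simp add: mult_mat_vec[of _ "Suc n" "Suc n"] col_mult2[of _ "Suc n" "Suc n" _ "Suc n"]
      col_carrier_vec[of _ "Suc n"] del: col_mult)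
  finally have col0: "col H 0 = e \<cdot>\<^sub>v unit_vec (Suc n) 0" using W' by simp
  have H0: "H $$ (i,0) = 0" "H $$ (0,i) = 0" if "0 < i" "i < Suc n" for i
  proof -
    have "col H 0 $ i = 0" using that by (simp add: col0)
    then show 1: "H $$ (i,0) = 0" using that H by simp
    then show "H $$ (0,i) = 0" using that H arg_cong[OF Hsym, of "\<lambda>A. A $$ (i,0)"] by simp
  qed
  define G' where "G' = mat n n (\<lambda>(i,j). H $$ (Suc i, Suc j))"
  have G': "G' \<in> carrier_mat n n" by (simp add: G'_def)
  have "transpose_mat G' = G'"
  proof (rule eq_matI)
    fix i j assume "i < dim_row G'" "j < dim_col G'"
    then have ij: "i < n" "j < n" using G' by auto
    show "transpose_mat G' $$ (i,j) = G' $$ (i,j)"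
      using arg_cong[OF Hsym, of "\<lambda>A. A $$ (Suc i,Suc j)"] H ij by (simp add: G'_def)
  qed (use G' in auto)
  then obtain P where P: "P \<in> orthogonal_group n" and D: "diagonal_mat (transpose_mat P * G' * P)"
    using Suc.IH[OF _ G'] by metis
  note P' = orthogonal_groupD[OF P]
  have Hblock: "H = four_block_mat (e \<cdot>\<^sub>m 1\<^sub>m 1) (0\<^sub>m 1 n) (0\<^sub>m n 1) G'"
  proof (rule eq_matI)
    fix i j assume "i < dim_row (four_block_mat (e \<cdot>\<^sub>m 1\<^sub>m 1) (0\<^sub>m 1 n) (0\<^sub>m n 1) G')"
      "j < dim_col (four_block_mat (e \<cdot>\<^sub>m 1\<^sub>m 1) (0\<^sub>m 1 n) (0\<^sub>m n 1) G')"
    then have ij: "i < Suc n" "j < Suc n" using G' by auto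
    have "H $$ (0,0) = e" using arg_cong[OF col0, of "\<lambda>v. vec_index v 0"] H by simp
    then show "H $$ (i,j) = four_block_mat (e \<cdot>\<^sub>m 1\<^sub>m 1) (0\<^sub>m 1 n) (0\<^sub>m n 1) G' $$ (i,j)"
      using H0[of i] H0[of j] ij G' by (cases i; cases j) (auto simp: G'_def)
  qed (use H G' in auto)
  define B where "B = four_block_mat (1\<^sub>m 1) (0\<^sub>m 1 n) (0\<^sub>m n 1) P"
  have B: "B \<in> carrier_mat (Suc n) (Suc n)" using P' by (auto simp: B_def)
  have BT: "transpose_mat B = four_block_mat (1\<^sub>m 1) (0\<^sub>m 1 n) (0\<^sub>m n 1) (transpose_mat P)"
    unfolding B_def by (subst transpose_four_block_mat[of _ 1 1 _ n _ n]) (use P' in auto)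
  have "transpose_mat B * B = four_block_mat (1\<^sub>m 1) (0\<^sub>m 1 n) (0\<^sub>m n 1) (transpose_mat P * P)"
    unfolding BT unfolding B_def
    by (subst mult_four_block_mat[of _ 1 1 _ n _ n _ _ 1 _ n]) (use P'(1) in auto)
  also have "\<dots> = 1\<^sub>m (Suc n)" unfolding P'(2) by (rule eq_matI) auto
  finally have "transpose_mat B * B = 1\<^sub>m (Suc n)" .
  then have BO: "B \<in> orthogonal_group (Suc n)" using B by (auto simp: orthogonal_group_def)
  have "transpose_mat B * H = four_block_mat (e \<cdot>\<^sub>m 1\<^sub>m 1) (0\<^sub>m 1 n) (0\<^sub>m n 1) (transpose_mat P * G')"
    unfolding BT Hblock
    by (subst mult_four_block_mat[of _ 1 1 _ n _ n _ _ 1 _ n]) (use P'(1) G' in auto)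
  then have BHB: "transpose_mat B * H * B =
      four_block_mat (e \<cdot>\<^sub>m 1\<^sub>m 1) (0\<^sub>m 1 n) (0\<^sub>m n 1) (transpose_mat P * G' * P)"
    unfolding B_def
    by (simp only:, subst mult_four_block_mat[of _ 1 1 _ n _ n _ _ 1 _ n]) (use P'(1) G' in auto)
  have "transpose_mat (W * B) * G * (W * B) = transpose_mat B * H * B"
    using B W' G by (simp add: H_def transpose_mult[of _ "Suc n" "Suc n" _ "Suc n"] assoc_mult_mat[of _ "Suc n" "Suc n" _ "Suc n" _ "Suc n"])
  moreover have "diagonal_mat (transpose_mat B * H * B)"
    unfolding BHB using D P' G' by (auto simp: diagonal_mat_def)
  ultimately show ?case using Suc.prems(1)[OF orthogonal_group_mult[OF W BO]] by simp
qed

section \<open>Singular values and their extremal characterisation\<close>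

lemma gram_index:
  assumes "A \<in> carrier_mat m n" "i < n" "j < n"
  shows "(transpose_mat A * A) $$ (i,j) = col A i \<bullet> col A j"
  using assms by simp

lemma diagonal_mat_mult_vec_index:
  assumes "D \<in> carrier_mat n n" "diagonal_mat D" "z \<in> carrier_vec n" "i < n"
  shows "(D *\<^sub>v z) $ i = D $$ (i,i) * (z $ i :: real)"
proof -
  have "(D *\<^sub>v z) $ i = (\<Sum>j<n. D $$ (i,j) * z $ j)"
    using assms by (simp add: scalar_prod_def lessThan_atLeast0)
  also have "\<dots> = (\<Sum>j<n. if j = i then D $$ (i,i) * z $ i else 0)"
    using assms by (intro sum.cong) (auto simp: diagonal_mat_def)
  finally show ?thesis using assms by simp
qed

lemma sq_norm_mult_mat_vec:
  fixes A :: "real mat"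
  assumes A: "A \<in> carrier_mat m n" and x: "x \<in> carrier_vec n"
  shows "(A *\<^sub>v x) \<bullet> (A *\<^sub>v x) = ((transpose_mat A * A) *\<^sub>v x) \<bullet> x"
proof -
  have "(A *\<^sub>v x) \<bullet> (A *\<^sub>v x) = (transpose_mat A *\<^sub>v (A *\<^sub>v x)) \<bullet> x"
    by (rule transpose_vec_mult_scalar[symmetric]) (use A x in auto)
  also have "transpose_mat A *\<^sub>v (A *\<^sub>v x) = (transpose_mat A * A) *\<^sub>v x"
    by (rule assoc_mult_mat_vec[symmetric]) (use A x in auto)
  finally show ?thesis .
qed

lemma sq_norm_mult_of_diagonal:
  assumes A: "A \<in> carrier_mat n n" and D: "diagonal_mat (transpose_mat A * A)"
    and z: "z \<in> carrier_vec n"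
  shows "(A *\<^sub>v z) \<bullet> (A *\<^sub>v z) = (\<Sum>i<n. (transpose_mat A * A) $$ (i,i) * (z $ i :: real)\<^sup>2)"
proof -
  let ?D = "transpose_mat A * A"
  have C: "?D \<in> carrier_mat n n" using A by auto
  have "(A *\<^sub>v z) \<bullet> (A *\<^sub>v z) = (\<Sum>i<n. (?D *\<^sub>v z) $ i * z $ i)"
    unfolding sq_norm_mult_mat_vec[OF A z] using z
    by (simp add: scalar_prod_def lessThan_atLeast0 del: index_mult_mat_vec)
  also have "\<dots> = (\<Sum>i<n. ?D $$ (i,i) * (z $ i)\<^sup>2)"
    by (intro sum.cong refl) (simp add: diagonal_mat_mult_vec_index[OF C D z] power2_eq_square del: index_mult_mat_vec index_mult_mat)
  finally show ?thesis .
qed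

lemma proots_char_poly_diagonal:
  fixes D :: "real mat"
  assumes "D \<in> carrier_mat n n" "diagonal_mat D"
  shows "proots (char_poly D) = mset (map (\<lambda>i. D $$ (i,i)) [0..<n])"
proof -
  have "upper_triangular D" using assms by (auto simp: upper_triangular_def diagonal_mat_def)
  then have "char_poly D = (\<Prod>a\<leftarrow>map (\<lambda>i. D $$ (i,i)) [0..<n]. [:- a, 1:])"
    using assms char_poly_upper_triangular[of D n] by (simp add: diag_mat_def)
  moreover have "proots (\<Prod>a\<leftarrow>xs. [:- a, 1:]) = mset xs" for xs :: "real list"
  proof (induction xs)
    case (Cons a xs)
    have "(\<Prod>a\<leftarrow>xs. [:- a, 1:]) \<noteq> (0 :: real poly)" by (auto simp: prod_list_zero_iff)
    then show ?case using Cons by (simp only: list.map prod_list.Cons, subst proots_mult) auto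
  qed simp
  ultimately show ?thesis by metis
qed

text \<open>The part of the singular value decomposition that is needed: the right singular vectors, i.e. an
orthonormal eigenbasis of \<open>A\<^sup>T A\<close> permuted so that its eigenvalues come in the order of the list
\<open>singular_values A\<close>. Norms of vectors \<open>A x\<close> are then explicit.\<close>

lemma singular_values_right_basis:
  assumes A: "A \<in> carrier_mat n n"
  obtains Q where "Q \<in> orthogonal_group n"
    "\<And>z. z \<in> carrier_vec n \<Longrightarrow>
       (A *\<^sub>v (Q *\<^sub>v z)) \<bullet> (A *\<^sub>v (Q *\<^sub>v z)) = (\<Sum>i<n. (singular_values A ! i)\<^sup>2 * (z $ i)\<^sup>2)"
    "length (singular_values A) = n"
    "\<forall>s\<in>set (singular_values A). 0 \<le> s"
proof -
  let ?G = "transpose_mat A * A"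
  have G: "?G \<in> carrier_mat n n" using A by auto
  have sym: "transpose_mat ?G = ?G" using A by (simp add: transpose_mult[of _ n n _ n])
  obtain Q where Q: "Q \<in> orthogonal_group n" and D: "diagonal_mat (transpose_mat Q * ?G * Q)"
    using symmetric_mat_diagonalization[OF G sym] .
  note Q' = orthogonal_groupD[OF Q]
  define d where "d i = (transpose_mat Q * ?G * Q) $$ (i,i)" for i
  have DC: "transpose_mat Q * ?G * Q \<in> carrier_mat n n" using Q' G by auto
  have AQ: "A * Q \<in> carrier_mat n n" using A Q' by auto
  have Deq: "transpose_mat (A * Q) * (A * Q) = transpose_mat Q * ?G * Q"
    using A Q' by (simp add: transpose_mult[of _ n n _ n] assoc_mult_mat[of _ n n _ n _ n])
  have d0: "0 \<le> d i" if "i < n" for i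
  proof -
    have "d i = col (A * Q) i \<bullet> col (A * Q) i"
      unfolding d_def Deq[symmetric] by (rule gram_index[OF AQ that that])
    then show ?thesis using sq_norm_nonneg by simp
  qed
  have "similar_mat_wit ?G (transpose_mat Q * ?G * Q) Q (transpose_mat Q)"
  proof (rule similar_mat_witI[OF Q'(3,2) _ G DC Q'(1)])
    have "Q * (transpose_mat Q * ?G * Q) * transpose_mat Q = (Q * transpose_mat Q) * ?G * (Q * transpose_mat Q)"
      using Q'(1) G by (simp add: assoc_mult_mat[of _ n n _ n _ n])
    then show "?G = Q * (transpose_mat Q * ?G * Q) * transpose_mat Q"
      unfolding Q'(3) left_mult_one_mat[OF G] right_mult_one_mat[OF G] by simp
  qed (use Q'(1) in simp)
  then have "char_poly ?G = char_poly (transpose_mat Q * ?G * Q)"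
    by (intro char_poly_similar) (auto simp: similar_mat_def)
  then have "image_mset sqrt (proots (char_poly ?G)) = mset (map (\<lambda>i. sqrt (d i)) [0..<n])"
    using proots_char_poly_diagonal[OF DC D] by (simp add: d_def multiset.map_comp o_def)
  then have mset: "mset (singular_values A) = mset (map (\<lambda>i. sqrt (d i)) [0..<n])"
    by (simp add: singular_values_def)
  then obtain p where p: "p permutes {..<n}" and sv0: "permute_list p (map (\<lambda>i. sqrt (d i)) [0..<n]) = singular_values A"
    using mset_eq_permutation[of "singular_values A" "map (\<lambda>i. sqrt (d i)) [0..<n]"] by auto
  have pn: "p i < n" if "i < n" for i using permutes_in_image[OF p, of i] that by auto
  have sv: "singular_values A = map (\<lambda>i. sqrt (d (p i))) [0..<n]"
    unfolding sv0[symmetric] permute_list_def using pn by auto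
  have pinj: "p i = p j \<longleftrightarrow> i = j" for i j using permutes_inj[OF p] by (auto dest: injD)
  define W where "W = mat_of_cols n (map (\<lambda>j. col Q (p j)) [0..<n])"
  have W: "W \<in> carrier_mat n n" by (auto simp: W_def)
  have col: "col W i = col Q (p i)" if "i < n" for i
    using that pn[OF that] Q'(1) unfolding W_def by (subst col_mat_of_cols) auto
  have "transpose_mat W * W = 1\<^sub>m n"
  proof (rule eq_matI)
    fix i j assume "i < dim_row (1\<^sub>m n)" "j < dim_col (1\<^sub>m n)"
    then have ij: "i < n" "j < n" by auto
    have "(transpose_mat W * W) $$ (i,j) = (transpose_mat Q * Q) $$ (p i,p j)"
      using ij pn W Q'(1) by (simp add: col)
    then show "(transpose_mat W * W) $$ (i,j) = 1\<^sub>m n $$ (i,j)"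
      unfolding Q'(2) using ij pn pinj by simp
  qed (use W in auto)
  then have WO: "W \<in> orthogonal_group n" using W by (auto simp: orthogonal_group_def)
  have AW: "A * W \<in> carrier_mat n n" using A W by auto
  have entry: "(transpose_mat (A * W) * (A * W)) $$ (i,j) = (transpose_mat Q * ?G * Q) $$ (p i, p j)"
    if "i < n" "j < n" for i j
  proof -
    have "col (A * W) i = col (A * Q) (p i)" if "i < n" for i
      using A W Q'(1) that pn by (simp add: col_mult2[of _ n n _ n] col del: col_mult)
    then show ?thesis
      unfolding Deq[symmetric] gram_index[OF AW that] gram_index[OF AQ pn[OF that(1)] pn[OF that(2)]]
      using that by simp
  qed
  have "diagonal_mat (transpose_mat (A * W) * (A * W))"
    unfolding diagonal_mat_def
  proof (intro allI impI)
    fix i j assume "i < dim_row (transpose_mat (A * W) * (A * W))"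
      "j < dim_col (transpose_mat (A * W) * (A * W))" "i \<noteq> j"
    then have ij: "i < n" "j < n" "p i \<noteq> p j" using W pinj by auto
    show "(transpose_mat (A * W) * (A * W)) $$ (i,j) = 0"
      unfolding entry[OF ij(1,2)] using D pn[OF ij(1)] pn[OF ij(2)] ij(3)
      unfolding diagonal_mat_def carrier_matD[OF DC] by blast
  qed
  then have "((A * W) *\<^sub>v z) \<bullet> ((A * W) *\<^sub>v z) =
      (\<Sum>i<n. (transpose_mat (A * W) * (A * W)) $$ (i,i) * (z $ i)\<^sup>2)"
    if "z \<in> carrier_vec n" for z
    using sq_norm_mult_of_diagonal[OF AW _ that] by blast
  moreover have "(transpose_mat (A * W) * (A * W)) $$ (i,i) = (singular_values A ! i)\<^sup>2" if "i < n" for i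
    unfolding entry[OF that that] using d0[OF pn[OF that]] that by (simp add: sv d_def del: index_mult_mat)
  ultimately have "((A * W) *\<^sub>v z) \<bullet> ((A * W) *\<^sub>v z) = (\<Sum>i<n. (singular_values A ! i)\<^sup>2 * (z $ i)\<^sup>2)"
    if "z \<in> carrier_vec n" for z
    using that by (simp del: index_mult_mat)
  moreover have "(A * W) *\<^sub>v z = A *\<^sub>v (W *\<^sub>v z)" if "z \<in> carrier_vec n" for z
    by (rule assoc_mult_mat_vec[OF A W that])
  ultimately have "(A *\<^sub>v (W *\<^sub>v z)) \<bullet> (A *\<^sub>v (W *\<^sub>v z)) = (\<Sum>i<n. (singular_values A ! i)\<^sup>2 * (z $ i)\<^sup>2)"
    if "z \<in> carrier_vec n" for z using that by metis
  moreover have "length (singular_values A) = n" by (simp add: sv)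
  moreover have "\<forall>s\<in>set (singular_values A). 0 \<le> s" using d0 pn by (auto simp: sv)
  ultimately show thesis by (rule that[OF WO])
qed

lemma length_singular_values:
  assumes "A \<in> carrier_mat n n"
  shows "length (singular_values A) = n"
  by (rule singular_values_right_basis[OF assms]) simp

lemma singular_values_nonneg:
  assumes "A \<in> carrier_mat n n" "i < n"
  shows "0 \<le> singular_values A ! i"
  by (rule singular_values_right_basis[OF assms(1)]) (use assms(2) in auto)

lemma singular_values_antimono:
  assumes "A \<in> carrier_mat n n" "i \<le> j" "j < n"
  shows "singular_values A ! j \<le> singular_values A ! i"
proof -
  have "sorted (rev (singular_values A))" by (simp add: singular_values_def)
  then show ?thesis using assms length_singular_values[OF assms(1)] by (simp add: sorted_rev_iff_nth_mono)
qed

lemma sigma_max_nth: 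
  assumes "A \<in> carrier_mat n n" "0 < n" shows "sigma_max A = singular_values A ! 0"
  unfolding sigma_max_def
proof (rule Max_eqI)
  fix y assume "y \<in> set (singular_values A)"
  then show "y \<le> singular_values A ! 0"
    using assms singular_values_antimono[of A n 0] length_singular_values[OF assms(1)] by (auto simp: in_set_conv_nth)
qed (use assms length_singular_values[OF assms(1)] in simp_all)

lemma sigma_min_nth: 
  assumes "A \<in> carrier_mat n n" "0 < n" shows "sigma_min A = singular_values A ! (n - 1)"
  unfolding sigma_min_def
proof (rule Min_eqI)
  fix y assume "y \<in> set (singular_values A)"
  then show "singular_values A ! (n - 1) \<le> y"
    using assms singular_values_antimono[of A n _ "n - 1"] length_singular_values[OF assms(1)] by (auto simp: in_set_conv_nth)
qed (use assms length_singular_values[OF assms(1)] in simp_all)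

lemma sigma_min_nonneg: "A \<in> carrier_mat n n \<Longrightarrow> 0 < n \<Longrightarrow> 0 \<le> sigma_min A"
  by (simp add: sigma_min_nth singular_values_nonneg)

lemma sigma_max_nonneg: "A \<in> carrier_mat n n \<Longrightarrow> 0 < n \<Longrightarrow> 0 \<le> sigma_max A"
  by (simp add: sigma_max_nth singular_values_nonneg)

lemma orthogonal_vec_preimage:
  assumes "Q \<in> orthogonal_group n" "x \<in> carrier_vec n"
  shows "transpose_mat Q *\<^sub>v x \<in> carrier_vec n" "Q *\<^sub>v (transpose_mat Q *\<^sub>v x) = x"
  using orthogonal_groupD[OF assms(1)] assms(2) by (auto simp flip: assoc_mult_mat_vec[of _ n n _ n])

lemma sigma_min_le:
  assumes A: "A \<in> carrier_mat n n" and x: "x \<in> carrier_vec n" and n: "0 < n"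
  shows "(sigma_min A)\<^sup>2 * (x \<bullet> x) \<le> (A *\<^sub>v x) \<bullet> (A *\<^sub>v x)"
proof -
  obtain Q where Q: "Q \<in> orthogonal_group n" and
    exp: "\<And>z. z \<in> carrier_vec n \<Longrightarrow>
       (A *\<^sub>v (Q *\<^sub>v z)) \<bullet> (A *\<^sub>v (Q *\<^sub>v z)) = (\<Sum>i<n. (singular_values A ! i)\<^sup>2 * (z $ i)\<^sup>2)"
    by (rule singular_values_right_basis[OF A]) blast
  define z where "z = transpose_mat Q *\<^sub>v x"
  note z = orthogonal_vec_preimage[OF Q x, folded z_def]
  have "(sigma_min A)\<^sup>2 * (x \<bullet> x) = (\<Sum>i<n. (sigma_min A)\<^sup>2 * (z $ i)\<^sup>2)"
    using orthogonal_group_sq_norm[OF Q z(1)] sq_norm_sum[OF z(1)] z by (simp add: sum_distrib_left)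
  also have "\<dots> \<le> (\<Sum>i<n. (singular_values A ! i)\<^sup>2 * (z $ i)\<^sup>2)"
    using singular_values_antimono[OF A] singular_values_nonneg[OF A] n
    by (intro sum_mono mult_right_mono power_mono) (auto simp: sigma_min_nth[OF A n])
  finally show ?thesis using exp[OF z(1)] z by simp
qed

lemma le_sigma_max:
  assumes A: "A \<in> carrier_mat n n" and x: "x \<in> carrier_vec n" and n: "0 < n"
  shows "(A *\<^sub>v x) \<bullet> (A *\<^sub>v x) \<le> (sigma_max A)\<^sup>2 * (x \<bullet> x)"
proof -
  obtain Q where Q: "Q \<in> orthogonal_group n" and
    exp: "\<And>z. z \<in> carrier_vec n \<Longrightarrow>
       (A *\<^sub>v (Q *\<^sub>v z)) \<bullet> (A *\<^sub>v (Q *\<^sub>v z)) = (\<Sum>i<n. (singular_values A ! i)\<^sup>2 * (z $ i)\<^sup>2)"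
    by (rule singular_values_right_basis[OF A]) blast
  define z where "z = transpose_mat Q *\<^sub>v x"
  note z = orthogonal_vec_preimage[OF Q x, folded z_def]
  have "(A *\<^sub>v x) \<bullet> (A *\<^sub>v x) = (\<Sum>i<n. (singular_values A ! i)\<^sup>2 * (z $ i)\<^sup>2)"
    using exp[OF z(1)] z by simp
  also have "\<dots> \<le> (\<Sum>i<n. (sigma_max A)\<^sup>2 * (z $ i)\<^sup>2)"
    using singular_values_antimono[OF A] singular_values_nonneg[OF A] n
    by (intro sum_mono mult_right_mono power_mono) (auto simp: sigma_max_nth[OF A n])
  also have "\<dots> = (sigma_max A)\<^sup>2 * (x \<bullet> x)"
    using orthogonal_group_sq_norm[OF Q z(1)] sq_norm_sum[OF z(1)] z by (simp add: sum_distrib_left)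
  finally show ?thesis .
qed

lemma singular_value_attained:
  assumes A: "A \<in> carrier_mat n n" and k: "k < n"
  obtains x where "x \<in> carrier_vec n" "x \<bullet> x = 1" "(A *\<^sub>v x) \<bullet> (A *\<^sub>v x) = (singular_values A ! k)\<^sup>2"
proof -
  obtain Q where Q: "Q \<in> orthogonal_group n" and
    exp: "\<And>z. z \<in> carrier_vec n \<Longrightarrow>
       (A *\<^sub>v (Q *\<^sub>v z)) \<bullet> (A *\<^sub>v (Q *\<^sub>v z)) = (\<Sum>i<n. (singular_values A ! i)\<^sup>2 * (z $ i)\<^sup>2)"
    by (rule singular_values_right_basis[OF A]) blast
  have "(\<Sum>i<n. (singular_values A ! i)\<^sup>2 * (unit_vec n k $ i)\<^sup>2)
      = (\<Sum>i<n. if i = k then (singular_values A ! k)\<^sup>2 else 0)"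
    using k by (intro sum.cong) auto
  then have "(A *\<^sub>v (Q *\<^sub>v unit_vec n k)) \<bullet> (A *\<^sub>v (Q *\<^sub>v unit_vec n k)) = (singular_values A ! k)\<^sup>2"
    using exp[of "unit_vec n k"] k by simp
  moreover have "(Q *\<^sub>v unit_vec n k) \<bullet> (Q *\<^sub>v unit_vec n k) = 1"
    using orthogonal_group_sq_norm[OF Q, of "unit_vec n k"] k by simp
  moreover have "Q *\<^sub>v unit_vec n k \<in> carrier_vec n" using orthogonal_groupD(1)[OF Q] by simp
  ultimately show thesis using that by blast
qed

text \<open>Lower bounds on \<open>sigma_min\<close> and its measurability thus become questions about quadratic forms.\<close>

lemma le_sigma_min_iff:
  assumes A: "A \<in> carrier_mat n n" and n: "0 < n" and c: "0 \<le> c"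
  shows "c \<le> sigma_min A \<longleftrightarrow> (\<forall>x\<in>carrier_vec n. c\<^sup>2 * (x \<bullet> x) \<le> (A *\<^sub>v x) \<bullet> (A *\<^sub>v x))"
proof
  assume *: "c \<le> sigma_min A"
  show "\<forall>x\<in>carrier_vec n. c\<^sup>2 * (x \<bullet> x) \<le> (A *\<^sub>v x) \<bullet> (A *\<^sub>v x)"
  proof
    fix x :: "real vec" assume x: "x \<in> carrier_vec n"
    have "c\<^sup>2 * (x \<bullet> x) \<le> (sigma_min A)\<^sup>2 * (x \<bullet> x)"
      using * c sq_norm_nonneg by (intro mult_right_mono power_mono)
    with sigma_min_le[OF A x n] show "c\<^sup>2 * (x \<bullet> x) \<le> (A *\<^sub>v x) \<bullet> (A *\<^sub>v x)" by simp
  qed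
next
  assume *: "\<forall>x\<in>carrier_vec n. c\<^sup>2 * (x \<bullet> x) \<le> (A *\<^sub>v x) \<bullet> (A *\<^sub>v x)"
  have "n - 1 < n" using n by simp
  from singular_value_attained[OF A this]
  obtain x where "x \<in> carrier_vec n" "x \<bullet> x = 1" "(A *\<^sub>v x) \<bullet> (A *\<^sub>v x) = (sigma_min A)\<^sup>2"
    unfolding sigma_min_nth[OF A n] by blast
  then have "c\<^sup>2 \<le> (sigma_min A)\<^sup>2" using * by force
  then show "c \<le> sigma_min A" using sigma_min_nonneg[OF A n] by (rule power2_le_imp_le)
qed

lemma sigma_max_le:
  assumes A: "A \<in> carrier_mat n n" and n: "0 < n" and c: "0 \<le> c"
    and *: "\<And>x. x\<in>carrier_vec n \<Longrightarrow> (A *\<^sub>v x) \<bullet> (A *\<^sub>v x) \<le> c\<^sup>2 * (x \<bullet> x)"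
  shows "sigma_max A \<le> c"
proof -
  obtain x where "x \<in> carrier_vec n" "x \<bullet> x = 1" "(A *\<^sub>v x) \<bullet> (A *\<^sub>v x) = (sigma_max A)\<^sup>2"
    using singular_value_attained[OF A n] unfolding sigma_max_nth[OF A n] by blast
  then have "(sigma_max A)\<^sup>2 \<le> c\<^sup>2" using * by force
  then show ?thesis using c by (rule power2_le_imp_le)
qed

section \<open>Blocks and linear systems\<close>

definition block :: "real mat \<Rightarrow> nat \<Rightarrow> nat \<Rightarrow> nat \<Rightarrow> nat \<Rightarrow> real mat" where
  "block A i0 m j0 k = mat m k (\<lambda>(i,j). A $$ (i0 + i, j0 + j))"

lemma block_carrier [simp]: "block A i0 m j0 k \<in> carrier_mat m k"
  by (simp add: block_def)

lemma block_mult_vec_carrier [simp]: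
  "x \<in> carrier_vec k \<Longrightarrow> block A i0 m j0 k *\<^sub>v x \<in> carrier_vec m"
  by (rule mult_mat_vec_carrier[OF block_carrier])

lemma mult_mat_zero_vec: "A \<in> carrier_mat m n \<Longrightarrow> A *\<^sub>v 0\<^sub>v n = (0\<^sub>v m :: real vec)"
  by (intro eq_vecI) auto

lemma zero_mat_mult_vec: "x \<in> carrier_vec n \<Longrightarrow> 0\<^sub>m m n *\<^sub>v x = (0\<^sub>v m :: real vec)"
  by (intro eq_vecI) auto

lemma four_block_mat_block:
  assumes "A \<in> carrier_mat n n" "r \<le> n"
  shows "A = four_block_mat (block A 0 r 0 r) (block A 0 r r (n - r))
    (block A r (n - r) 0 r) (block A r (n - r) r (n - r))"
  using assms by (intro eq_matI) (auto simp: block_def)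

lemma mult_vec_append:
  assumes "A \<in> carrier_mat n n" "r \<le> n" "y \<in> carrier_vec r" "x \<in> carrier_vec (n - r)"
  shows "A *\<^sub>v (y @\<^sub>v x) =
    (block A 0 r 0 r *\<^sub>v y + block A 0 r r (n - r) *\<^sub>v x) @\<^sub>v
    (block A r (n - r) 0 r *\<^sub>v y + block A r (n - r) r (n - r) *\<^sub>v x)"
  by (subst four_block_mat_block[OF assms(1,2)])
    (rule four_block_mat_mult_vec[OF block_carrier block_carrier block_carrier block_carrier assms(3,4)])

lemma append_carrier_vec_diff:
  "y \<in> carrier_vec r \<Longrightarrow> x \<in> carrier_vec (n - r) \<Longrightarrow> r \<le> n \<Longrightarrow> y @\<^sub>v x \<in> carrier_vec n"
  using append_carrier_vec[of y r x "n - r"] by simp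

text \<open>\<open>pick S i\<close> enumerates \<open>S\<close> increasingly from \<open>i = 0\<close>; on an interval this is a shift, so that the
submatrices with consecutive rows and columns are blocks.\<close>

lemma pick_atLeastLessThan: "i < b - a \<Longrightarrow> pick {a..<b} i = a + i"
proof -
  assume i: "i < b - a"
  then have "{c\<in>{a..<b}. c < a + i} = {a..<a+i}" by auto
  then show ?thesis using pick_card_in_set[of "a + i" "{a..<b}"] i by auto
qed

lemma submatrix_leading:
  assumes "A \<in> carrier_mat n n" "r \<le> n"
  shows "submatrix A {..<r} {..<r} = block A 0 r 0 r"
proof -
  have "{i. i < n \<and> i \<in> {..<r}} = {..<r}" using assms by auto
  then show ?thesis using assms pick_atLeastLessThan[of _ r 0]
    by (auto simp: submatrix_def block_def lessThan_atLeast0 intro!: eq_matI)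
qed

lemma submatrix_trailing:
  assumes "A \<in> carrier_mat n n" "r \<le> n"
  shows "submatrix A {r..<n} {r..<n} = block A r (n - r) r (n - r)"
proof -
  have "{i. i < n \<and> i \<in> {r..<n}} = {r..<n}" using assms by auto
  then show ?thesis using assms pick_atLeastLessThan[of _ n r]
    by (auto simp: submatrix_def block_def intro!: eq_matI)
qed

lemma sq_norm_append:
  "y \<in> carrier_vec r \<Longrightarrow> x \<in> carrier_vec m \<Longrightarrow> (y @\<^sub>v x) \<bullet> (y @\<^sub>v x) = y \<bullet> y + x \<bullet> (x :: real vec)"
  by (rule scalar_prod_append)

text \<open>The form in which dimension counting is used below: \<open>n - 1\<close> homogeneous linear conditions on \<open>n\<close>
unknowns, padded with a zero row to a square matrix, have a nonzero solution.\<close>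

lemma kernel_vector_of_zero_row:
  fixes N :: "real mat"
  assumes N: "N \<in> carrier_mat n n" and k: "k < n" and zero: "\<And>j. j < n \<Longrightarrow> N $$ (k,j) = 0"
  obtains v where "v \<in> carrier_vec n" "v \<noteq> 0\<^sub>v n" "N *\<^sub>v v = 0\<^sub>v n"
proof -
  have "transpose_mat N *\<^sub>v unit_vec n k = 0\<^sub>v n"
    using N k zero by (intro eq_vecI) auto
  moreover have "unit_vec n k \<noteq> (0\<^sub>v n :: real vec)" using k by (metis index_unit_vec(1) index_zero_vec(1) zero_neq_one)
  ultimately have "det (transpose_mat N) = 0"
    using det_0_iff_vec_prod_zero[of "transpose_mat N" n] N by (metis transpose_carrier_mat unit_vec_carrier)
  then have "det N = 0" using det_transpose[OF N] by simp
  then show thesis using det_0_iff_vec_prod_zero[OF N] that by auto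
qed

lemma solve_linear_system:
  fixes N :: "real mat"
  assumes N: "N \<in> carrier_mat n n" and det: "det N \<noteq> 0" and b: "b \<in> carrier_vec n"
  obtains y where "y \<in> carrier_vec n" "N *\<^sub>v y = b"
proof -
  note adj = adj_mat[OF N]
  define y where "y = (1 / det N) \<cdot>\<^sub>v (adj_mat N *\<^sub>v b)"
  have ab: "adj_mat N *\<^sub>v b \<in> carrier_vec n" using adj(1) b by auto
  have "N *\<^sub>v y = (1 / det N) \<cdot>\<^sub>v ((N * adj_mat N) *\<^sub>v b)"
    using mult_mat_vec[OF N ab] assoc_mult_mat_vec[OF N adj(1) b] by (simp add: y_def)
  also have "(N * adj_mat N) *\<^sub>v b = det N \<cdot>\<^sub>v b"
    unfolding adj(2) using b by (intro eq_vecI) (auto simp: row_smult)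
  also have "(1 / det N) \<cdot>\<^sub>v (det N \<cdot>\<^sub>v b) = b" using det by (simp add: smult_smult_assoc)
  finally show thesis using that[of y] ab by (simp add: y_def)
qed

lemma det_nonzero_if_bounded_below:
  fixes N :: "real mat"
  assumes N: "N \<in> carrier_mat n n" and f: "0 < f"
    and low: "\<And>y. y \<in> carrier_vec n \<Longrightarrow> f\<^sup>2 * (y \<bullet> y) \<le> (N *\<^sub>v y) \<bullet> (N *\<^sub>v y)"
  shows "det N \<noteq> 0"
proof
  assume "det N = 0"
  then obtain y where y: "y \<in> carrier_vec n" "y \<noteq> 0\<^sub>v n" "N *\<^sub>v y = 0\<^sub>v n"
    using det_0_iff_vec_prod_zero[OF N] by auto
  then have "f\<^sup>2 * (y \<bullet> y) \<le> 0" using low[OF y(1)] by simp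
  then show False using f y sq_norm_nonneg[of y] sq_norm_eq_0_iff[OF y(1)] 
    by (simp add: mult_le_0_iff)
qed

text \<open>A square matrix and its transpose have the same smallest singular value. If \<open>f > 0\<close>, then \<open>N\<close> is
invertible, so \<open>x = N y\<close> with \<open>f |y| \<le> |x|\<close>, and expanding \<open>|N\<^sup>T x - f\<^sup>2 y|\<^sup>2 \<ge> 0\<close> gives the
claim because \<open>(N\<^sup>T x) \<bullet> y = x \<bullet> x\<close>.\<close>

lemma bounded_below_transpose:
  fixes N :: "real mat"
  assumes N: "N \<in> carrier_mat n n" and f: "0 \<le> f"
    and low: "\<And>y. y \<in> carrier_vec n \<Longrightarrow> f\<^sup>2 * (y \<bullet> y) \<le> (N *\<^sub>v y) \<bullet> (N *\<^sub>v y)"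
    and x: "x \<in> carrier_vec n"
  shows "f\<^sup>2 * (x \<bullet> x) \<le> (transpose_mat N *\<^sub>v x) \<bullet> (transpose_mat N *\<^sub>v x)"
proof (cases "f = 0")
  case True
  then show ?thesis by (simp add: sq_norm_nonneg)
next
  case False
  then have fpos: "0 < f" using f by simp
  obtain y where y: "y \<in> carrier_vec n" "N *\<^sub>v y = x"
    using solve_linear_system[OF N det_nonzero_if_bounded_below[OF N fpos low] x] by blast
  define w where "w = transpose_mat N *\<^sub>v x"
  have w: "w \<in> carrier_vec n" using N x by (auto simp: w_def)
  have xy: "x \<bullet> x = w \<bullet> y" using transpose_vec_mult_scalar[OF N y(1) x] y by (simp add: w_def)
  have low': "f\<^sup>2 * (y \<bullet> y) \<le> x \<bullet> x" using low[OF y(1)] y by simp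
  have "0 \<le> (w - f\<^sup>2 \<cdot>\<^sub>v y) \<bullet> (w - f\<^sup>2 \<cdot>\<^sub>v y)" by (rule sq_norm_nonneg)
  also have "\<dots> = w \<bullet> w - 2 * f\<^sup>2 * (w \<bullet> y) + f\<^sup>2 * (f\<^sup>2 * (y \<bullet> y))"
    using w y comm_scalar_prod[OF w y(1)]
    by (simp add: minus_scalar_prod_distrib[of _ n] scalar_prod_minus_distrib[of _ n] algebra_simps)
  also have "\<dots> \<le> w \<bullet> w - 2 * f\<^sup>2 * (x \<bullet> x) + f\<^sup>2 * (x \<bullet> x)"
    unfolding xy[symmetric] using low' by (intro add_left_mono mult_left_mono) auto
  finally show ?thesis by (simp add: w_def algebra_simps)
qed

section \<open>The blocks of the triangular factor\<close>

lemma sum_weighted_squares_le: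
  fixes s :: "nat \<Rightarrow> real"
  assumes z: "z \<in> carrier_vec n" and s: "\<And>i j. i \<le> j \<Longrightarrow> j < n \<Longrightarrow> s j \<le> s i" "\<And>i. i < n \<Longrightarrow> 0 \<le> s i"
    and k: "k < n" and 0: "\<And>i. i < k \<Longrightarrow> z $ i = 0"
  shows "(\<Sum>i<n. (s i)\<^sup>2 * (z $ i)\<^sup>2) \<le> (s k)\<^sup>2 * (z \<bullet> z)"
proof -
  have "(\<Sum>i<n. (s i)\<^sup>2 * (z $ i)\<^sup>2) \<le> (\<Sum>i<n. (s k)\<^sup>2 * (z $ i)\<^sup>2)"
  proof (intro sum_mono)
    fix i assume "i \<in> {..<n}"
    then show "(s i)\<^sup>2 * (z $ i)\<^sup>2 \<le> (s k)\<^sup>2 * (z $ i)\<^sup>2"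
      using s 0[of i] by (cases "i < k") (auto intro!: mult_right_mono power_mono)
  qed
  then show ?thesis by (simp add: sq_norm_sum[OF z] sum_distrib_left)
qed

lemma sum_weighted_squares_ge:
  fixes s :: "nat \<Rightarrow> real"
  assumes z: "z \<in> carrier_vec n" and s: "\<And>i j. i \<le> j \<Longrightarrow> j < n \<Longrightarrow> s j \<le> s i" "\<And>i. i < n \<Longrightarrow> 0 \<le> s i"
    and k: "k < n" and 0: "\<And>i. k < i \<Longrightarrow> i < n \<Longrightarrow> z $ i = 0"
  shows "(s k)\<^sup>2 * (z \<bullet> z) \<le> (\<Sum>i<n. (s i)\<^sup>2 * (z $ i)\<^sup>2)"
proof -
  have "(\<Sum>i<n. (s k)\<^sup>2 * (z $ i)\<^sup>2) \<le> (\<Sum>i<n. (s i)\<^sup>2 * (z $ i)\<^sup>2)"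
  proof (intro sum_mono)
    fix i assume "i \<in> {..<n}"
    then show "(s k)\<^sup>2 * (z $ i)\<^sup>2 \<le> (s i)\<^sup>2 * (z $ i)\<^sup>2"
      using s k 0[of i] by (cases "k < i") (auto intro!: mult_right_mono power_mono)
  qed
  then show ?thesis by (simp add: sq_norm_sum[OF z] sum_distrib_left)
qed

text \<open>The situation after all orthogonal factors of \<open>A\<close> have been stripped off: \<open>R\<close> is upper triangular
and \<open>|R w|\<close> is the norm of \<open>diag(s) Y w\<close> for an orthogonal matrix \<open>Y\<close>. In the application
\<open>s i\<close> is the singular value \<open>\<sigma>\<^sub>i\<^sub>+\<^sub>1\<close> of \<open>A\<close> (indices of \<open>s\<close> start at 0) and \<open>Y\<close> is the
transpose of the Haar matrix.\<close>

locale rank_revealing =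
  fixes R Y :: "real mat" and s :: "nat \<Rightarrow> real" and n r :: nat
  assumes R: "R \<in> carrier_mat n n" and ut: "upper_triangular R"
    and Y: "Y \<in> orthogonal_group n" and r: "1 \<le> r" "r < n"
    and s_mono: "\<And>i j. i \<le> j \<Longrightarrow> j < n \<Longrightarrow> s j \<le> s i"
    and s_nonneg: "\<And>i. i < n \<Longrightarrow> 0 \<le> s i"
    and norm_R: "\<And>w. w \<in> carrier_vec n \<Longrightarrow>
      (R *\<^sub>v w) \<bullet> (R *\<^sub>v w) = (\<Sum>i<n. (s i)\<^sup>2 * ((Y *\<^sub>v w) $ i)\<^sup>2)"
begin

abbreviation "R11 \<equiv> block R 0 r 0 r"
abbreviation "R12 \<equiv> block R 0 r r (n - r)"
abbreviation "R22 \<equiv> block R r (n - r) r (n - r)"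
abbreviation "Y11 \<equiv> block Y 0 r 0 r"
abbreviation "Y12 \<equiv> block Y 0 r r (n - r)"

lemma Y_carrier: "Y \<in> carrier_mat n n"
  by (rule orthogonal_groupD(1)[OF Y])

lemma R21_zero: "block R r (n - r) 0 r = 0\<^sub>m (n - r) r"
  using R ut r by (intro eq_matI) (auto simp: block_def upper_triangular_def)

lemma norm_R_append:
  assumes y: "y \<in> carrier_vec r" and x: "x \<in> carrier_vec (n - r)"
  shows "(R *\<^sub>v (y @\<^sub>v x)) \<bullet> (R *\<^sub>v (y @\<^sub>v x)) =
    (R11 *\<^sub>v y + R12 *\<^sub>v x) \<bullet> (R11 *\<^sub>v y + R12 *\<^sub>v x) + (R22 *\<^sub>v x) \<bullet> (R22 *\<^sub>v x)"
proof -
  have "R *\<^sub>v (y @\<^sub>v x) = (R11 *\<^sub>v y + R12 *\<^sub>v x) @\<^sub>v (0\<^sub>v (n - r) + R22 *\<^sub>v x)"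
    using mult_vec_append[OF R less_imp_le[OF r(2)] y x] y unfolding R21_zero by (simp add: zero_mat_mult_vec)
  also have "0\<^sub>v (n - r) + R22 *\<^sub>v x = R22 *\<^sub>v x"
    by (rule left_zero_vec[OF block_mult_vec_carrier[OF x]])
  finally show ?thesis
    using y x by (simp add: sq_norm_append[of _ r _ "n - r"])
qed

text \<open>As \<open>R\<close> is upper triangular, its first \<open>r\<close> columns have the same norms of linear combinations as
the leading block.\<close>

lemma norm_R11:
  assumes y: "y \<in> carrier_vec r"
  shows "(R11 *\<^sub>v y) \<bullet> (R11 *\<^sub>v y) = (\<Sum>i<n. (s i)\<^sup>2 * ((Y *\<^sub>v (y @\<^sub>v 0\<^sub>v (n - r))) $ i)\<^sup>2)"
proof -
  have "R11 *\<^sub>v y + R12 *\<^sub>v 0\<^sub>v (n - r) = R11 *\<^sub>v y" "R22 *\<^sub>v 0\<^sub>v (n - r) = 0\<^sub>v (n - r)"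
    using y by (simp_all add: mult_mat_zero_vec[OF block_carrier] right_zero_vec[of _ r])
  then show ?thesis
    using norm_R_append[OF y, of "0\<^sub>v (n - r)"] norm_R[of "y @\<^sub>v 0\<^sub>v (n - r)"] y r
    by (simp add: append_carrier_vec_diff)
qed

lemma Y_leading:
  assumes y: "y \<in> carrier_vec r" and x: "x \<in> carrier_vec (n - r)" and i: "i < r"
  shows "(Y *\<^sub>v (y @\<^sub>v x)) $ i = (Y11 *\<^sub>v y) $ i + (Y12 *\<^sub>v x) $ i"
  using mult_vec_append[OF Y_carrier less_imp_le[OF r(2)] y x] i
    carrier_vecD[OF block_mult_vec_carrier[OF y, of Y 0 r 0]] carrier_vecD[OF block_mult_vec_carrier[OF x, of Y 0 r r]]
  by (simp del: index_mult_mat_vec dim_mult_mat_vec)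

lemma norm_Y: "w \<in> carrier_vec n \<Longrightarrow> (Y *\<^sub>v w) \<bullet> (Y *\<^sub>v w) = w \<bullet> w"
  by (rule orthogonal_group_sq_norm[OF Y])

lemma Y_mult_carrier [simp]: "w \<in> carrier_vec n \<Longrightarrow> Y *\<^sub>v w \<in> carrier_vec n"
  using Y_carrier by auto

lemma pad_carrier: "y \<in> carrier_vec r \<Longrightarrow> y @\<^sub>v 0\<^sub>v (n - r) \<in> carrier_vec n"
  using r by (simp add: append_carrier_vec_diff)

lemma norm_pad: "y \<in> carrier_vec r \<Longrightarrow> (y @\<^sub>v 0\<^sub>v (n - r)) \<bullet> (y @\<^sub>v 0\<^sub>v (n - r)) = (y \<bullet> y :: real)"
  by (simp add: sq_norm_append[of _ r _ "n - r"])

lemma Y_pad_leading: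
  assumes y: "y \<in> carrier_vec r" and i: "i < r"
  shows "(Y *\<^sub>v (y @\<^sub>v 0\<^sub>v (n - r))) $ i = (Y11 *\<^sub>v y) $ i"
  using Y_leading[OF y zero_carrier_vec i] i mult_mat_zero_vec[OF block_carrier, of Y 0 r r "n - r"] by simp

lemma norm_leading_part_le:
  assumes "u \<in> carrier_vec r" "w \<in> carrier_vec n" "\<And>i. i < r \<Longrightarrow> u $ i = w $ i"
  shows "u \<bullet> u \<le> (w \<bullet> w :: real)"
proof -
  have "(\<Sum>i<r. (u $ i)\<^sup>2) = (\<Sum>i<r. (w $ i)\<^sup>2)" using assms(3) by simp
  also have "\<dots> \<le> (\<Sum>i<n. (w $ i)\<^sup>2)" using r by (intro sum_mono2) auto
  finally show ?thesis using assms(1,2) by (simp add: sq_norm_sum)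
qed

text \<open>Only the first \<open>r\<close> coordinates of \<open>Y (y, 0)\<close> are kept; they form \<open>Y11 y\<close> and carry weights at
least \<open>s (r - 1)\<close>.\<close>

lemma sigma_min_R11_ge:
  assumes f: "0 \<le> f" and low: "\<And>y. y \<in> carrier_vec r \<Longrightarrow> f\<^sup>2 * (y \<bullet> y) \<le> (Y11 *\<^sub>v y) \<bullet> (Y11 *\<^sub>v y)"
  shows "f * s (r - 1) \<le> sigma_min R11"
proof -
  have s0: "0 \<le> s (r - 1)" using s_nonneg r by auto
  have "(f * s (r - 1))\<^sup>2 * (y \<bullet> y) \<le> (R11 *\<^sub>v y) \<bullet> (R11 *\<^sub>v y)" if y: "y \<in> carrier_vec r" for y
  proof -
    let ?z = "Y *\<^sub>v (y @\<^sub>v 0\<^sub>v (n - r))"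
    have "(f * s (r - 1))\<^sup>2 * (y \<bullet> y) \<le> (s (r - 1))\<^sup>2 * ((Y11 *\<^sub>v y) \<bullet> (Y11 *\<^sub>v y))"
      using mult_left_mono[OF low[OF y], of "(s (r - 1))\<^sup>2"] by (simp add: power_mult_distrib mult_ac)
    also have "\<dots> = (\<Sum>i<r. (s (r - 1))\<^sup>2 * (?z $ i)\<^sup>2)"
      using y by (simp add: sq_norm_sum[OF block_mult_vec_carrier[OF y]] sum_distrib_left Y_pad_leading del: index_mult_mat_vec)
    also have "\<dots> \<le> (\<Sum>i<r. (s i)\<^sup>2 * (?z $ i)\<^sup>2)"
      using s_mono r s0 by (intro sum_mono mult_right_mono power_mono) auto
    also have "\<dots> \<le> (\<Sum>i<n. (s i)\<^sup>2 * (?z $ i)\<^sup>2)"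
      using r by (intro sum_mono2) auto
    also have "\<dots> = (R11 *\<^sub>v y) \<bullet> (R11 *\<^sub>v y)" by (rule norm_R11[OF y, symmetric])
    finally show ?thesis .
  qed
  then show ?thesis using le_sigma_min_iff[OF block_carrier, of r "f * s (r - 1)" R 0 0] f s0 r by simp
qed

text \<open>Test vector: some \<open>y \<noteq> 0\<close> in the \<open>r\<close>-dimensional space satisfies the \<open>r - 1\<close> conditions that the
first \<open>r - 1\<close> coordinates of \<open>Y (y, 0)\<close> vanish, so that only weights up to \<open>s (r - 1)\<close> remain.\<close>

lemma sigma_min_R11_le: "sigma_min R11 \<le> s (r - 1)"
proof -
  \<comment> \<open>The last row is the padding of the \<open>r - 1\<close> conditions.\<close>
  define N where "N = mat r r (\<lambda>(i,j). if i < r - 1 then Y $$ (i,j) else 0)"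
  obtain y where y: "y \<in> carrier_vec r" "y \<noteq> 0\<^sub>v r" and Ny: "N *\<^sub>v y = 0\<^sub>v r"
    by (rule kernel_vector_of_zero_row[of N r "r - 1"]) (use r in \<open>auto simp: N_def\<close>)
  let ?z = "Y *\<^sub>v (y @\<^sub>v 0\<^sub>v (n - r))"
  have z: "?z \<in> carrier_vec n" using pad_carrier[OF y(1)] by simp
  have z0: "?z $ i = 0" if "i < r - 1" for i
  proof -
    have "row Y11 i = row N i" using that by (intro eq_vecI) (auto simp: N_def block_def)
    then have "(Y11 *\<^sub>v y) $ i = (N *\<^sub>v y) $ i" using that by (simp add: N_def block_def)
    then show ?thesis using Y_pad_leading[OF y(1), of i] that Ny by simp
  qed
  have "(sigma_min R11)\<^sup>2 * (y \<bullet> y) \<le> (R11 *\<^sub>v y) \<bullet> (R11 *\<^sub>v y)"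
    using sigma_min_le[OF block_carrier y(1)] r by simp
  also have "\<dots> = (\<Sum>i<n. (s i)\<^sup>2 * (?z $ i)\<^sup>2)" by (rule norm_R11[OF y(1)])
  also have "\<dots> \<le> (s (r - 1))\<^sup>2 * (?z \<bullet> ?z)"
    by (rule sum_weighted_squares_le[OF z s_mono s_nonneg]) (use r z0 in auto)
  also have "?z \<bullet> ?z = y \<bullet> y" using norm_Y[OF pad_carrier[OF y(1)]] norm_pad[OF y(1)] by simp
  finally have "(sigma_min R11)\<^sup>2 \<le> (s (r - 1))\<^sup>2"
    using sq_norm_nonneg[of y] sq_norm_eq_0_iff[OF y(1)] y(2) by simp
  then show ?thesis by (rule power2_le_imp_le) (use s_nonneg r in auto)
qed

text \<open>Test vector: some \<open>w \<noteq> 0\<close> satisfies the \<open>n - 1\<close> conditions that the first \<open>r\<close> coordinates of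
\<open>R w\<close> and the last \<open>n - r - 1\<close> coordinates of \<open>Y w\<close> vanish. Then \<open>|R w|\<close> is at least \<open>s r |w|\<close>, and
it equals \<open>|R22 x|\<close>, where \<open>x\<close> is the trailing part of \<open>w\<close>.\<close>

lemma sigma_max_R22_ge: "s r \<le> sigma_max R22"
proof -
  \<comment> \<open>Row \<open>r\<close> is the padding; the other rows are the conditions.\<close>
  define N where "N = mat n n (\<lambda>(i,j). if i < r then R $$ (i,j) else if i = r then 0 else Y $$ (i,j))"
  obtain w where w: "w \<in> carrier_vec n" "w \<noteq> 0\<^sub>v n" and Nw: "N *\<^sub>v w = 0\<^sub>v n"
    by (rule kernel_vector_of_zero_row[of N n r]) (use r in \<open>auto simp: N_def\<close>)
  have R0: "(R *\<^sub>v w) $ i = 0" if "i < r" for i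
  proof -
    have "row R i = row N i" using that R r by (intro eq_vecI) (auto simp: N_def)
    then have "(R *\<^sub>v w) $ i = (N *\<^sub>v w) $ i" using that R r by (simp add: N_def)
    then show ?thesis using Nw that r by simp
  qed
  have Y0: "(Y *\<^sub>v w) $ i = 0" if "r < i" "i < n" for i
  proof -
    have "row Y i = row N i" using that Y_carrier by (intro eq_vecI) (auto simp: N_def)
    then have "(Y *\<^sub>v w) $ i = (N *\<^sub>v w) $ i" using that Y_carrier by (simp add: N_def)
    then show ?thesis using Nw that by simp
  qed
  define y x where "y = vec_first w r" and "x = vec_last w (n - r)"
  have yx: "y \<in> carrier_vec r" "x \<in> carrier_vec (n - r)" "y @\<^sub>v x = w"
    using w r vec_first_last_append[of w r "n - r"] by (auto simp: y_def x_def)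
  have "R11 *\<^sub>v y + R12 *\<^sub>v x = 0\<^sub>v r"
  proof (rule eq_vecI)
    fix i assume "i < dim_vec (0\<^sub>v r)"
    then have i: "i < r" by simp
    have "(R11 *\<^sub>v y + R12 *\<^sub>v x) $ i = (R *\<^sub>v (y @\<^sub>v x)) $ i"
      unfolding mult_vec_append[OF R less_imp_le[OF r(2)] yx(1,2)]
      using i by (subst index_append_vec) (auto simp: block_def)
    then show "(R11 *\<^sub>v y + R12 *\<^sub>v x) $ i = 0\<^sub>v r $ i" using R0[OF i] yx(3) i by simp
  qed (simp add: block_def)
  then have Rw: "(R *\<^sub>v w) \<bullet> (R *\<^sub>v w) = (R22 *\<^sub>v x) \<bullet> (R22 *\<^sub>v x)"
    using norm_R_append[OF yx(1,2)] yx(3) by simp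
  have "(s r)\<^sup>2 * (w \<bullet> w) = (s r)\<^sup>2 * ((Y *\<^sub>v w) \<bullet> (Y *\<^sub>v w))" using norm_Y[OF w(1)] by simp
  also have "\<dots> \<le> (\<Sum>i<n. (s i)\<^sup>2 * ((Y *\<^sub>v w) $ i)\<^sup>2)"
    by (rule sum_weighted_squares_ge[OF _ s_mono s_nonneg]) (use r Y0 w in auto)
  also have "\<dots> = (R22 *\<^sub>v x) \<bullet> (R22 *\<^sub>v x)" using norm_R[OF w(1)] Rw by simp
  also have "\<dots> \<le> (sigma_max R22)\<^sup>2 * (x \<bullet> x)"
    using le_sigma_max[OF block_carrier yx(2)] r by simp
  also have "\<dots> \<le> (sigma_max R22)\<^sup>2 * (w \<bullet> w)"
    using sq_norm_append[OF yx(1,2)] yx(3) sq_norm_nonneg[of y] by (intro mult_left_mono) auto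
  finally have "(s r)\<^sup>2 \<le> (sigma_max R22)\<^sup>2"
    using sq_norm_nonneg[of w] sq_norm_eq_0_iff[OF w(1)] w(2) by simp
  then show ?thesis by (rule power2_le_imp_le) (use sigma_max_nonneg[OF block_carrier] r in auto)
qed

lemma lower_bound_le_1:
  assumes low: "\<And>y. y \<in> carrier_vec r \<Longrightarrow> f\<^sup>2 * (y \<bullet> y) \<le> (Y11 *\<^sub>v y) \<bullet> (Y11 *\<^sub>v y)"
  shows "f \<le> 1"
proof -
  define e where "e = (unit_vec r 0 :: real vec)"
  have e: "e \<in> carrier_vec r" "e \<bullet> e = 1" using r by (auto simp: e_def)
  have "f\<^sup>2 \<le> (Y11 *\<^sub>v e) \<bullet> (Y11 *\<^sub>v e)" using low[OF e(1)] e(2) by simp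
  also have "\<dots> \<le> (Y *\<^sub>v (e @\<^sub>v 0\<^sub>v (n - r))) \<bullet> (Y *\<^sub>v (e @\<^sub>v 0\<^sub>v (n - r)))"
    using e Y_pad_leading[OF e(1)] pad_carrier[OF e(1)] by (intro norm_leading_part_le) auto
  also have "\<dots> = 1" using norm_Y[OF pad_carrier[OF e(1)]] norm_pad[OF e(1)] e(2) by simp
  finally have "f\<^sup>2 \<le> 1\<^sup>2" by simp
  then show ?thesis by (rule power2_le_imp_le) simp
qed

text \<open>For a given \<open>x\<close>, the vector \<open>R22 x\<close> is the trailing part of \<open>R (y, x)\<close> for every \<open>y\<close>. The choice
\<open>Y11 y = - Y12 x\<close> annihilates the first \<open>r\<close> coordinates of \<open>Y (y, x)\<close>, so that
\<open>|R (y, x)| \<le> s r |(y, x)|\<close>. Moreover \<open>f |y| \<le> |Y12 x| \<le> |x|\<close> and \<open>f \<le> 1\<close>, whence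
\<open>|(y, x)|\<^sup>2 \<le> 2 |x|\<^sup>2 / f\<^sup>2\<close>.\<close>

lemma sigma_max_R22_le:
  assumes f: "0 < f" and low: "\<And>y. y \<in> carrier_vec r \<Longrightarrow> f\<^sup>2 * (y \<bullet> y) \<le> (Y11 *\<^sub>v y) \<bullet> (Y11 *\<^sub>v y)"
  shows "sigma_max R22 \<le> sqrt 2 * s r / f"
proof (rule sigma_max_le[OF block_carrier])
  show "0 < n - r" "0 \<le> sqrt 2 * s r / f" using r f s_nonneg by auto
  fix x :: "real vec" assume x: "x \<in> carrier_vec (n - r)"
  have Y12x: "Y12 *\<^sub>v x \<in> carrier_vec r" using x by simp
  obtain y where y: "y \<in> carrier_vec r" and Yy: "Y11 *\<^sub>v y = - (Y12 *\<^sub>v x)"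
    by (rule solve_linear_system[OF block_carrier det_nonzero_if_bounded_below[OF block_carrier f low], of "- (Y12 *\<^sub>v x)"])
      (use Y12x in auto)
  let ?z = "Y *\<^sub>v (y @\<^sub>v x)"
  have w: "y @\<^sub>v x \<in> carrier_vec n" using y x r by (simp add: append_carrier_vec_diff)
  have z0: "?z $ i = 0" if "i < r" for i
    using Y_leading[OF y x that] carrier_vecD[OF Y12x] that unfolding Yy by simp
  have "(0\<^sub>v r @\<^sub>v x) \<in> carrier_vec n" using append_carrier_vec_diff[OF zero_carrier_vec x] r by simp
  note x' = this norm_Y[OF this]
  have "f\<^sup>2 * (y \<bullet> y) \<le> (Y12 *\<^sub>v x) \<bullet> (Y12 *\<^sub>v x)"
    using low[OF y] Y12x unfolding Yy by simp
  also have "\<dots> \<le> (Y *\<^sub>v (0\<^sub>v r @\<^sub>v x)) \<bullet> (Y *\<^sub>v (0\<^sub>v r @\<^sub>v x))"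
  proof (rule norm_leading_part_le[OF Y12x])
    fix i assume i: "i < r"
    show "(Y12 *\<^sub>v x) $ i = (Y *\<^sub>v (0\<^sub>v r @\<^sub>v x)) $ i"
      using Y_leading[OF zero_carrier_vec x i] i mult_mat_zero_vec[OF block_carrier, of Y 0 r 0 r] by simp
  qed (use x' in simp)
  also have "\<dots> = x \<bullet> x" using x'(2) sq_norm_append[OF zero_carrier_vec x, of r] by simp
  finally have fy: "f\<^sup>2 * (y \<bullet> y) \<le> x \<bullet> x" .
  have "f\<^sup>2 \<le> 1" using lower_bound_le_1[OF low] f by (simp add: power_le_one)
  then have "f\<^sup>2 * (x \<bullet> x) \<le> x \<bullet> x" using mult_right_mono[of "f\<^sup>2" 1 "x \<bullet> x"] sq_norm_nonneg[of x] by simp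
  with fy have "f\<^sup>2 * (y \<bullet> y + x \<bullet> x) \<le> 2 * (x \<bullet> x)" by (simp add: algebra_simps)
  then have yx: "y \<bullet> y + x \<bullet> x \<le> 2 * (x \<bullet> x) / f\<^sup>2" using f by (simp add: field_simps)
  have "(R22 *\<^sub>v x) \<bullet> (R22 *\<^sub>v x) \<le> (R *\<^sub>v (y @\<^sub>v x)) \<bullet> (R *\<^sub>v (y @\<^sub>v x))"
    unfolding norm_R_append[OF y x] using sq_norm_nonneg by simp
  also have "\<dots> = (\<Sum>i<n. (s i)\<^sup>2 * (?z $ i)\<^sup>2)" by (rule norm_R[OF w])
  also have "\<dots> \<le> (s r)\<^sup>2 * (?z \<bullet> ?z)"
    by (rule sum_weighted_squares_le[OF _ s_mono s_nonneg]) (use r z0 w in auto)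
  also have "?z \<bullet> ?z = y \<bullet> y + x \<bullet> x" using norm_Y[OF w] sq_norm_append[OF y x] by simp
  also have "(s r)\<^sup>2 * (y \<bullet> y + x \<bullet> x) \<le> (s r)\<^sup>2 * (2 * (x \<bullet> x) / f\<^sup>2)"
    using yx by (intro mult_left_mono) auto
  also have "\<dots> = (sqrt 2 * s r / f)\<^sup>2 * (x \<bullet> x)" by (simp add: power_mult_distrib power_divide)
  finally show "(R22 *\<^sub>v x) \<bullet> (R22 *\<^sub>v x) \<le> (sqrt 2 * s r / f)\<^sup>2 * (x \<bullet> x)" .
qed

end

section \<open>Bounds for a single output of the algorithm\<close>

text \<open>The bound \<open>\<surd>2 t / f\<close> only has to be weakened: \<open>1 / f \<le> 1 / f\<^sup>4\<close>, \<open>m / p \<ge> 1\<close>, and the denominator lies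
in the interval from 0 (excluded) to 1.\<close>

lemma crude_factor_bound:
  fixes f m p t :: real
  assumes f: "0 < f" "f \<le> 1" and p: "0 < p" "p \<le> m" and t: "0 \<le> t" "t < f * p"
  shows "sqrt 2 * t / f \<le> 3 * t * (f powi (-4) * (m / p) ^ 3 / (1 - t\<^sup>2 / (f\<^sup>2 * p\<^sup>2)))"
proof -
  have "t\<^sup>2 < (f * p)\<^sup>2" using t by (intro power_strict_mono) auto
  then have "t\<^sup>2 / (f\<^sup>2 * p\<^sup>2) < 1" using f p by (simp add: power_mult_distrib)
  moreover have "0 \<le> t\<^sup>2 / (f\<^sup>2 * p\<^sup>2)" by simp
  ultimately have d: "0 < 1 - t\<^sup>2 / (f\<^sup>2 * p\<^sup>2)" "1 - t\<^sup>2 / (f\<^sup>2 * p\<^sup>2) \<le> 1" by linarith+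
  have inv: "1 \<le> 1 / f" using f by simp
  have "1 / f \<le> (1 / f) ^ 4" using power_increasing[OF _ inv, of 1 4] by simp
  then have "1 / f \<le> f powi (-4)" by (simp add: power_int_minus power_one_over inverse_eq_divide)
  moreover have "1 \<le> (m / p) ^ 3" using p by (intro one_le_power) simp
  ultimately have "1 / f * 1 \<le> f powi (-4) * (m / p) ^ 3" using f by (intro mult_mono) auto
  then have "1 / f \<le> f powi (-4) * (m / p) ^ 3 / 1" by simp
  also have "\<dots> \<le> f powi (-4) * (m / p) ^ 3 / (1 - t\<^sup>2 / (f\<^sup>2 * p\<^sup>2))"
    using d f p by (intro divide_left_mono) auto
  finally have 1: "1 / f \<le> f powi (-4) * (m / p) ^ 3 / (1 - t\<^sup>2 / (f\<^sup>2 * p\<^sup>2))" .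
  have 2: "sqrt 2 * t \<le> 3 * t" using sqrt2_less_2 t by (intro mult_right_mono) linarith+
  have "(sqrt 2 * t) * (1 / f) \<le> 3 * t * (f powi (-4) * (m / p) ^ 3 / (1 - t\<^sup>2 / (f\<^sup>2 * p\<^sup>2)))"
    by (rule mult_mono[OF 2 1]) (use t f in auto)
  then show ?thesis by simp
qed

text \<open>From \<open>A V\<^sup>T = U R\<close> it follows that \<open>|R w| = |A V\<^sup>T w|\<close>, and \<open>V\<^sup>T w = Q Y w\<close> for \<open>Y = (V Q)\<^sup>T\<close>. The basis
\<open>Q\<close> depends on \<open>A\<close> only; this matters for the distribution of \<open>V Q\<close>.\<close>

lemma rurv_singular_value_bounds:
  assumes A: "A \<in> carrier_mat n n" and r: "1 \<le> r" "r < n" and V: "V \<in> orthogonal_group n"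
    and qr: "qr_decomposition n (A * transpose_mat V) U R"
    and Q: "Q \<in> orthogonal_group n"
    and basis: "\<forall>z\<in>carrier_vec n.
       (A *\<^sub>v (Q *\<^sub>v z)) \<bullet> (A *\<^sub>v (Q *\<^sub>v z)) = (\<Sum>i<n. (singular_values A ! i)\<^sup>2 * (z $ i)\<^sup>2)"
  defines "f \<equiv> sigma_min (submatrix (V * Q) {..<r} {..<r})"
  shows "f * sing_val A r \<le> sigma_min (submatrix R {..<r} {..<r})"
    and "sigma_min (submatrix R {..<r} {..<r}) \<le> sing_val A r"
    and "sing_val A (r + 1) \<le> sigma_max (submatrix R {r..<n} {r..<n})"
    and "0 < f \<Longrightarrow> sigma_max (submatrix R {r..<n} {r..<n}) \<le> sqrt 2 * sing_val A (r + 1) / f"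
    and "f \<le> 1" and "0 \<le> f"
proof -
  have U: "U \<in> orthogonal_group n" and R: "R \<in> carrier_mat n n" and ut: "upper_triangular R"
    and AUR: "A * transpose_mat V = U * R" using qr by (auto simp: qr_decomposition_def)
  note V' = orthogonal_groupD[OF V] and Q' = orthogonal_groupD[OF Q] and U' = orthogonal_groupD[OF U]
  define X where "X = V * Q"
  have X: "X \<in> orthogonal_group n" unfolding X_def by (rule orthogonal_group_mult[OF V Q])
  have XC: "X \<in> carrier_mat n n" by (rule orthogonal_groupD(1)[OF X])
  define Y where "Y = transpose_mat X"
  have Y: "Y \<in> orthogonal_group n" unfolding Y_def by (rule orthogonal_group_transpose[OF X])
  have norm_R: "(R *\<^sub>v w) \<bullet> (R *\<^sub>v w) = (\<Sum>i<n. (singular_values A ! i)\<^sup>2 * ((Y *\<^sub>v w) $ i)\<^sup>2)"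
    if w: "w \<in> carrier_vec n" for w
  proof -
    define v where "v = transpose_mat V *\<^sub>v w"
    have v: "v \<in> carrier_vec n" using V'(1) w by (simp add: v_def)
    have Yw: "Y *\<^sub>v w = transpose_mat Q *\<^sub>v v"
      using V'(1) Q'(1) w by (simp add: Y_def X_def v_def transpose_mult[of _ n n _ n] assoc_mult_mat_vec[of _ n n _ n])
    have "(R *\<^sub>v w) \<bullet> (R *\<^sub>v w) = (U *\<^sub>v (R *\<^sub>v w)) \<bullet> (U *\<^sub>v (R *\<^sub>v w))"
      by (rule orthogonal_group_sq_norm[OF U, symmetric]) (use R w in simp)
    also have "U *\<^sub>v (R *\<^sub>v w) = (U * R) *\<^sub>v w"
      by (rule assoc_mult_mat_vec[symmetric, OF U'(1) R w])
    also have "\<dots> = A *\<^sub>v v"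
      unfolding AUR[symmetric] v_def by (rule assoc_mult_mat_vec[OF A _ w]) (use V'(1) in simp)
    also have "v = Q *\<^sub>v (Y *\<^sub>v w)" unfolding Yw by (rule orthogonal_vec_preimage(2)[OF Q v, symmetric])
    finally show ?thesis using basis[rule_format, of "Y *\<^sub>v w"] orthogonal_groupD(1)[OF Y] w by simp
  qed
  interpret rank_revealing R Y "\<lambda>i. singular_values A ! i" n r
    by unfold_locales
      (use R ut Y r norm_R singular_values_antimono[OF A] singular_values_nonneg[OF A] in auto)
  have sub: "submatrix R {..<r} {..<r} = R11" "submatrix R {r..<n} {r..<n} = R22"
    "submatrix (V * Q) {..<r} {..<r} = block X 0 r 0 r"
    using R XC r by (simp_all add: submatrix_leading submatrix_trailing X_def)
  have sv: "sing_val A r = singular_values A ! (r - 1)" "sing_val A (r + 1) = singular_values A ! r"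
    by (simp_all add: sing_val_def)
  have r0: "0 < r" using r by simp
  show f0: "0 \<le> f" unfolding f_def sub by (rule sigma_min_nonneg[OF block_carrier r0])
  have Y11: "Y11 = transpose_mat (block X 0 r 0 r)"
    using XC r by (intro eq_matI) (auto simp: Y_def block_def)
  have low: "f\<^sup>2 * (y \<bullet> y) \<le> (Y11 *\<^sub>v y) \<bullet> (Y11 *\<^sub>v y)" if "y \<in> carrier_vec r" for y
    unfolding Y11 using sigma_min_le[OF block_carrier _ r0] 
    by (intro bounded_below_transpose[OF block_carrier f0 _ that]) (simp add: f_def sub)
  show "f * sing_val A r \<le> sigma_min (submatrix R {..<r} {..<r})"
    unfolding sub sv by (rule sigma_min_R11_ge[OF f0 low])
  show "sigma_min (submatrix R {..<r} {..<r}) \<le> sing_val A r"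
    unfolding sub sv by (rule sigma_min_R11_le)
  show "sing_val A (r + 1) \<le> sigma_max (submatrix R {r..<n} {r..<n})"
    unfolding sub sv by (rule sigma_max_R22_ge)
  show "sigma_max (submatrix R {r..<n} {r..<n}) \<le> sqrt 2 * sing_val A (r + 1) / f" if "0 < f"
    unfolding sub sv by (rule sigma_max_R22_le[OF that low])
  show "f \<le> 1" by (rule lower_bound_le_1[OF low])
qed

section \<open>Product Lebesgue measure and linear maps\<close>

lemma sets_lebesgue_product: "sets (\<Pi>\<^sub>M i\<in>I. (lborel :: real measure)) = sets (\<Pi>\<^sub>M i\<in>I. borel)"
  by (rule sets_PiM_cong) simp_all

abbreviation lebesgue_product :: "'i set \<Rightarrow> ('i \<Rightarrow> real) measure" where
  "lebesgue_product I \<equiv> \<Pi>\<^sub>M i\<in>I. lborel"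

text \<open>Translations (\<open>c = 1\<close>) and point reflections (\<open>c = -1\<close>) preserve product Lebesgue measure, because
they do so in each coordinate.\<close>

lemma distr_lebesgue_product_affine:
  fixes a :: "'i \<Rightarrow> real"
  assumes I: "finite I" and c: "\<bar>c\<bar> = 1"
  shows "distr (lebesgue_product I) (lebesgue_product I) (\<lambda>x. \<lambda>i\<in>I. a i + c * x i) = lebesgue_product I"
proof -
  interpret product_sigma_finite "\<lambda>_::'i. lborel :: real measure" ..
  show ?thesis
  proof (rule PiM_eqI[OF I])
    fix A :: "'i \<Rightarrow> real set" assume A: "\<And>i. i \<in> I \<Longrightarrow> A i \<in> sets lborel"
    have [measurable]: "(\<lambda>t. a i + c * t) \<in> borel_measurable borel" for i by measurable
    have inv: "emeasure lborel ((\<lambda>t. a i + c * t) -` A i) = emeasure lborel (A i)" if "i \<in> I" for i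
    proof -
      have "lborel = density (distr lborel borel (\<lambda>t. a i + c * t)) (\<lambda>_. ennreal \<bar>c\<bar>)"
        using c by (intro lborel_real_affine) auto
      then have *: "distr lborel borel (\<lambda>t. a i + c * t) = lborel" using c by (simp add: density_1)
      have "emeasure (distr lborel borel (\<lambda>t. a i + c * t)) (A i) = emeasure lborel ((\<lambda>t. a i + c * t) -` A i \<inter> space lborel)"
        by (rule emeasure_distr) (use A[OF that] in auto)
      then show ?thesis unfolding * by simp
    qed
    have "emeasure (distr (lebesgue_product I) (lebesgue_product I) (\<lambda>x. \<lambda>i\<in>I. a i + c * x i)) (Pi\<^sub>E I A) =
        emeasure (lebesgue_product I) ((\<lambda>x. \<lambda>i\<in>I. a i + c * x i) -` Pi\<^sub>E I A \<inter> space (lebesgue_product I))"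
    proof (rule emeasure_distr)
      show "Pi\<^sub>E I A \<in> sets (lebesgue_product I)" by (rule sets_PiM_I_finite[OF I A])
    qed measurable
    also have "(\<lambda>x. \<lambda>i\<in>I. a i + c * x i) -` Pi\<^sub>E I A \<inter> space (lebesgue_product I) =
        Pi\<^sub>E I (\<lambda>i. (\<lambda>t. a i + c * t) -` A i)"
      by (auto simp: space_PiM PiE_iff)
    also have "emeasure (lebesgue_product I) \<dots> = (\<Prod>i\<in>I. emeasure lborel ((\<lambda>t. a i + c * t) -` A i))"
    proof (rule emeasure_PiM[OF I])
      fix i assume "i \<in> I"
      then show "(\<lambda>t. a i + c * t) -` A i \<in> sets lborel"
        using A[of i] measurable_sets_borel[of "\<lambda>t. a i + c * t" borel "A i"] by simp
    qed
    also have "\<dots> = (\<Prod>i\<in>I. emeasure lborel (A i))" using inv by simp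
    finally show "emeasure (distr (lebesgue_product I) (lebesgue_product I) (\<lambda>x. \<lambda>i\<in>I. a i + c * x i)) (Pi\<^sub>E I A) =
        (\<Prod>i\<in>I. emeasure lborel (A i))" .
  qed simp
qed

lemma nn_integral_lebesgue_product_affine:
  fixes a :: "'i \<Rightarrow> real"
  assumes I: "finite I" and c: "\<bar>c\<bar> = 1" and h: "h \<in> borel_measurable (\<Pi>\<^sub>M i\<in>I. borel)"
  shows "(\<integral>\<^sup>+x. h (\<lambda>i\<in>I. a i + c * x i) \<partial>lebesgue_product I) = (\<integral>\<^sup>+x. h x \<partial>lebesgue_product I)"
proof -
  have "(\<integral>\<^sup>+x. h x \<partial>distr (lebesgue_product I) (lebesgue_product I) (\<lambda>x. \<lambda>i\<in>I. a i + c * x i)) =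
      (\<integral>\<^sup>+x. h (\<lambda>i\<in>I. a i + c * x i) \<partial>lebesgue_product I)"
    by (rule nn_integral_distr) (use h in \<open>simp_all cong: measurable_cong_sets\<close>)
  then show ?thesis unfolding distr_lebesgue_product_affine[OF I c] by simp
qed

text \<open>A linear map \<open>T\<close> that preserves an even function \<open>g\<close> of integral 1 preserves Lebesgue measure:
by translation and reflection invariance and Fubini's theorem,
\<open>\<integral> h(T x) dx = \<integral>\<integral> h(T x) g(T x - y) dy dx = \<integral>\<integral> h(y - T x) g(- T x) dx dy = (\<integral> h) (\<integral> g)\<close>,
where the middle step replaces \<open>x\<close> by \<open>y' - x\<close> with \<open>T y' = y\<close>. The assumption \<open>T_refl\<close> is the
combination of linearity and surjectivity that this step uses.\<close>

lemma lebesgue_product_linear_invariant: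
  fixes T :: "('i \<Rightarrow> real) \<Rightarrow> 'i \<Rightarrow> real"
  assumes I: "finite I"
    and T [measurable]: "T \<in> measurable (\<Pi>\<^sub>M i\<in>I. borel) (\<Pi>\<^sub>M i\<in>I. borel)"
    and g [measurable]: "g \<in> borel_measurable (\<Pi>\<^sub>M i\<in>I. borel)"
    and g1: "(\<integral>\<^sup>+x. g x \<partial>lebesgue_product I) = 1"
    and gT: "\<And>x. x \<in> space (lebesgue_product I) \<Longrightarrow> g (T x) = g x"
    and g_even: "\<And>x. x \<in> space (lebesgue_product I) \<Longrightarrow> g (\<lambda>i\<in>I. - x i) = g x"
    and T_refl: "\<And>y. y \<in> space (lebesgue_product I) \<Longrightarrow>
      \<exists>y'. \<forall>x\<in>space (lebesgue_product I). T (\<lambda>i\<in>I. y' i - x i) = (\<lambda>i\<in>I. y i - T x i)"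
    and h [measurable]: "h \<in> borel_measurable (\<Pi>\<^sub>M i\<in>I. borel)"
  shows "(\<integral>\<^sup>+x. h (T x) \<partial>lebesgue_product I) = (\<integral>\<^sup>+x. h x \<partial>lebesgue_product I)"
proof -
  let ?L = "lebesgue_product I"
  note sets_lebesgue_product [measurable_cong]
  interpret product_sigma_finite "\<lambda>_::'i. lborel :: real measure" ..
  interpret S: sigma_finite_measure ?L by (rule sigma_finite[OF I])
  interpret P: pair_sigma_finite ?L ?L ..
  have TS: "T x \<in> space ?L" if "x \<in> space ?L" for x using measurable_space[OF T, of x] that by (simp add: space_PiM)
  have [measurable]: "(\<lambda>(x, y). g (\<lambda>i\<in>I. T x i - y i)) \<in> borel_measurable (?L \<Otimes>\<^sub>M ?L)" by measurable
  have "(\<integral>\<^sup>+x. h (T x) \<partial>?L) = (\<integral>\<^sup>+x. (\<integral>\<^sup>+y. h (T x) * g y \<partial>?L) \<partial>?L)"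
    by (simp add: nn_integral_cmult g1)
  also have "\<dots> = (\<integral>\<^sup>+x. (\<integral>\<^sup>+y. h (T x) * g (\<lambda>i\<in>I. T x i - y i) \<partial>?L) \<partial>?L)"
  proof (rule nn_integral_cong)
    fix x assume x: "x \<in> space ?L"
    have [measurable]: "(\<lambda>y. g (\<lambda>i\<in>I. T x i - y i)) \<in> borel_measurable ?L" by measurable
    have "(\<integral>\<^sup>+y. g (\<lambda>i\<in>I. T x i - y i) \<partial>?L) = (\<integral>\<^sup>+y. g y \<partial>?L)"
      using nn_integral_lebesgue_product_affine[OF I, of "-1" g "T x"] by simp
    then show "(\<integral>\<^sup>+y. h (T x) * g y \<partial>?L) = (\<integral>\<^sup>+y. h (T x) * g (\<lambda>i\<in>I. T x i - y i) \<partial>?L)"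
      by (simp add: nn_integral_cmult)
  qed
  also have "\<dots> = (\<integral>\<^sup>+y. (\<integral>\<^sup>+x. h (T x) * g (\<lambda>i\<in>I. T x i - y i) \<partial>?L) \<partial>?L)"
    by (rule P.Fubini'[symmetric]) measurable
  also have "\<dots> = (\<integral>\<^sup>+y. (\<integral>\<^sup>+x. h (\<lambda>i\<in>I. y i - T x i) * g x \<partial>?L) \<partial>?L)"
  proof (rule nn_integral_cong)
    fix y assume y: "y \<in> space ?L"
    obtain y' where y': "\<forall>x\<in>space ?L. T (\<lambda>i\<in>I. y' i - x i) = (\<lambda>i\<in>I. y i - T x i)"
      using T_refl[OF y] by blast
    let ?k = "\<lambda>x. h (T x) * g (\<lambda>i\<in>I. T x i - y i)"
    have [measurable]: "?k \<in> borel_measurable ?L" using y by measurable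
    have "(\<integral>\<^sup>+x. ?k x \<partial>?L) = (\<integral>\<^sup>+x. ?k (\<lambda>i\<in>I. y' i + (-1) * x i) \<partial>?L)"
      by (rule nn_integral_lebesgue_product_affine[OF I, symmetric]) auto
    also have "\<dots> = (\<integral>\<^sup>+x. h (\<lambda>i\<in>I. y i - T x i) * g x \<partial>?L)"
    proof (rule nn_integral_cong)
      fix x assume x: "x \<in> space ?L"
      have "(\<lambda>i\<in>I. (\<lambda>i\<in>I. y i - T x i) i - y i) = (\<lambda>i\<in>I. - T x i)" by auto
      then show "?k (\<lambda>i\<in>I. y' i + (-1) * x i) = h (\<lambda>i\<in>I. y i - T x i) * g x"
        using y'[rule_format, OF x] g_even[OF TS[OF x]] gT[OF x] by simp
    qed
    finally show "(\<integral>\<^sup>+x. ?k x \<partial>?L) = (\<integral>\<^sup>+x. h (\<lambda>i\<in>I. y i - T x i) * g x \<partial>?L)" .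
  qed
  also have "\<dots> = (\<integral>\<^sup>+x. (\<integral>\<^sup>+y. h (\<lambda>i\<in>I. y i - T x i) * g x \<partial>?L) \<partial>?L)"
    by (rule P.Fubini') measurable
  also have "\<dots> = (\<integral>\<^sup>+x. (\<integral>\<^sup>+y. h y \<partial>?L) * g x \<partial>?L)"
  proof (rule nn_integral_cong)
    fix x assume x: "x \<in> space ?L"
    have [measurable]: "(\<lambda>y. h (\<lambda>i\<in>I. y i - T x i)) \<in> borel_measurable ?L" by measurable
    have "(\<integral>\<^sup>+y. h (\<lambda>i\<in>I. y i - T x i) \<partial>?L) = (\<integral>\<^sup>+y. h y \<partial>?L)"
      using nn_integral_lebesgue_product_affine[OF I, of 1 h "\<lambda>i. - T x i"] by simp
    then show "(\<integral>\<^sup>+y. h (\<lambda>i\<in>I. y i - T x i) * g x \<partial>?L) = (\<integral>\<^sup>+y. h y \<partial>?L) * g x"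
      by (simp add: nn_integral_multc)
  qed
  also have "\<dots> = (\<integral>\<^sup>+y. h y \<partial>?L)" by (simp add: nn_integral_cmult g1)
  finally show ?thesis .
qed

section \<open>The Gaussian law and its rotation invariance\<close>

lemma density_PiM_product:
  fixes p :: "real \<Rightarrow> ennreal"
  assumes I: "finite I" and p [measurable]: "p \<in> borel_measurable borel"
    and sf: "sigma_finite_measure (density lborel p)"
  shows "(\<Pi>\<^sub>M i\<in>I. density lborel p) = density (lebesgue_product I) (\<lambda>x. \<Prod>i\<in>I. p (x i))"
proof -
  interpret L: product_sigma_finite "\<lambda>_::'a. lborel :: real measure" ..
  interpret D: product_sigma_finite "\<lambda>_::'a. density lborel p"
    using sf by (simp add: product_sigma_finite_def)
  note sets_lebesgue_product [measurable_cong]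
  have [measurable]: "(\<lambda>x. \<Prod>i\<in>I. p (x i)) \<in> borel_measurable (lebesgue_product I)" by measurable
  show ?thesis
  proof (rule D.PiM_eqI[OF I, symmetric])
    show "sets (density (lebesgue_product I) (\<lambda>x. \<Prod>i\<in>I. p (x i))) = sets (\<Pi>\<^sub>M i\<in>I. density lborel p)"
      by (simp, rule sets_PiM_cong) simp_all
    fix A :: "'a \<Rightarrow> real set" assume A: "\<And>i. i \<in> I \<Longrightarrow> A i \<in> sets (density lborel p)"
    then have A': "\<And>i. i \<in> I \<Longrightarrow> A i \<in> sets lborel" by simp
    have box: "Pi\<^sub>E I A \<in> sets (lebesgue_product I)" by (rule sets_PiM_I_finite[OF I A'])
    have "emeasure (density (lebesgue_product I) (\<lambda>x. \<Prod>i\<in>I. p (x i))) (Pi\<^sub>E I A) =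
        (\<integral>\<^sup>+x. (\<Prod>i\<in>I. p (x i)) * indicator (Pi\<^sub>E I A) x \<partial>lebesgue_product I)"
      by (rule emeasure_density[OF _ box]) measurable
    also have "\<dots> = (\<integral>\<^sup>+x. (\<Prod>i\<in>I. p (x i) * indicator (A i) (x i)) \<partial>lebesgue_product I)"
    proof (rule nn_integral_cong)
      fix x :: "'a \<Rightarrow> real" assume x: "x \<in> space (lebesgue_product I)"
      have "indicator (Pi\<^sub>E I A) x = (\<Prod>i\<in>I. indicator (A i) (x i) :: ennreal)"
      proof (cases "x \<in> Pi\<^sub>E I A")
        case False
        then obtain i where "i \<in> I" "x i \<notin> A i" using x by (auto simp: space_PiM PiE_iff)
        then have "(\<Prod>i\<in>I. indicator (A i) (x i) :: ennreal) = 0" by (intro prod_zero[OF I] bexI[of _ i]) simp_all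
        then show ?thesis using False by simp
      qed (auto simp: PiE_iff)
      then show "(\<Prod>i\<in>I. p (x i)) * indicator (Pi\<^sub>E I A) x = (\<Prod>i\<in>I. p (x i) * indicator (A i) (x i))"
        by (simp add: prod.distrib)
    qed
    also have "\<dots> = (\<Prod>i\<in>I. \<integral>\<^sup>+t. p t * indicator (A i) t \<partial>lborel)"
      by (rule L.product_nn_integral_prod[OF I]) (use A' in \<open>auto intro!: borel_measurable_times borel_measurable_indicator\<close>)
    also have "\<dots> = (\<Prod>i\<in>I. emeasure (density lborel p) (A i))"
      using A' by (intro prod.cong refl emeasure_density[symmetric]) auto
    finally show "emeasure (density (lebesgue_product I) (\<lambda>x. \<Prod>i\<in>I. p (x i))) (Pi\<^sub>E I A) =
        (\<Prod>i\<in>I. emeasure (density lborel p) (A i))" .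
  qed
qed

abbreviation index_square :: "nat \<Rightarrow> (nat \<times> nat) set" where
  "index_square n \<equiv> {..<n} \<times> {..<n}"

abbreviation entry_space :: "nat \<Rightarrow> (nat \<times> nat \<Rightarrow> real) measure" where
  "entry_space n \<equiv> \<Pi>\<^sub>M ij\<in>index_square n. borel"

text \<open>Laws of random matrices live on functions that are \<open>undefined\<close> outside the index square;
\<open>entries n\<close> and \<open>mat n n\<close> translate between these functions and matrices.\<close>

definition entries :: "nat \<Rightarrow> real mat \<Rightarrow> nat \<times> nat \<Rightarrow> real" where
  "entries n X = (\<lambda>ij\<in>index_square n. X $$ ij)"

lemma mat_entries: "X \<in> carrier_mat n n \<Longrightarrow> mat n n (entries n X) = X"
  by (auto simp: entries_def)

lemma matrix_law_entries: "matrix_law M n X = distr M (entry_space n) (\<lambda>\<omega>. entries n (X \<omega>))"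
  by (simp add: matrix_law_def entries_def)

lemma entries_measurable:
  assumes "random_matrix M n X"
  shows "(\<lambda>\<omega>. entries n (X \<omega>)) \<in> measurable M (entry_space n)"
  unfolding entries_def by (rule measurable_restrict) (use assms in \<open>auto simp: random_matrix_def\<close>)

lemma mult_index_sum:
  fixes P Q :: "real mat"
  assumes "P \<in> carrier_mat n n" "Q \<in> carrier_mat n n" "i < n" "j < n"
  shows "(P * Q) $$ (i,j) = (\<Sum>k<n. P $$ (i,k) * Q $$ (k,j))"
  using assms by (simp add: scalar_prod_def lessThan_atLeast0)

lemma left_mult_measurable:
  assumes "Q \<in> carrier_mat n n"
  shows "(\<lambda>x. entries n (Q * mat n n x)) \<in> measurable (entry_space n) (entry_space n)"
  unfolding entries_def
proof (rule measurable_restrict)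
  fix ij assume ij: "ij \<in> index_square n"
  have "(\<lambda>x. \<Sum>k<n. Q $$ (fst ij, k) * x (k, snd ij)) \<in> borel_measurable (entry_space n)"
    using ij by (intro borel_measurable_sum borel_measurable_times measurable_component_singleton) auto
  also have "(\<lambda>x. \<Sum>k<n. Q $$ (fst ij, k) * x (k, snd ij)) = (\<lambda>x. (Q * mat n n x) $$ ij)"
    using ij mult_index_sum[OF assms mat_carrier, of "fst ij" "snd ij"] by (intro ext) auto
  finally show "(\<lambda>x. (Q * mat n n x) $$ ij) \<in> borel_measurable (entry_space n)" .
qed

lemma right_mult_measurable:
  assumes "Q \<in> carrier_mat n n"
  shows "(\<lambda>x. entries n (mat n n x * Q)) \<in> measurable (entry_space n) (entry_space n)"
  unfolding entries_def
proof (rule measurable_restrict)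
  fix ij assume ij: "ij \<in> index_square n"
  have "(\<lambda>x. \<Sum>k<n. x (fst ij, k) * Q $$ (k, snd ij)) \<in> borel_measurable (entry_space n)"
    using ij by (intro borel_measurable_sum borel_measurable_times measurable_component_singleton) auto
  also have "(\<lambda>x. \<Sum>k<n. x (fst ij, k) * Q $$ (k, snd ij)) = (\<lambda>x. (mat n n x * Q) $$ ij)"
    using ij mult_index_sum[OF mat_carrier assms, of "fst ij" "snd ij"] by (intro ext) auto
  finally show "(\<lambda>x. (mat n n x * Q) $$ ij) \<in> borel_measurable (entry_space n)" .
qed

lemma random_matrix_mult_left:
  assumes X: "random_matrix M n X" and Q: "Q \<in> carrier_mat n n"
  shows "random_matrix M n (\<lambda>\<omega>. Q * X \<omega>)"
    and "matrix_law M n (\<lambda>\<omega>. Q * X \<omega>) = distr (matrix_law M n X) (entry_space n) (\<lambda>x. entries n (Q * mat n n x))"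
proof -
  have XC: "\<And>\<omega>. \<omega> \<in> space M \<Longrightarrow> X \<omega> \<in> carrier_mat n n" using X by (simp add: random_matrix_def)
  have *: "(\<lambda>\<omega>. entries n (Q * mat n n (entries n (X \<omega>)))) \<in> measurable M (entry_space n)"
    by (rule measurable_compose[OF entries_measurable[OF X] left_mult_measurable[OF Q]])
  have m: "(\<lambda>\<omega>. entries n (Q * X \<omega>)) \<in> measurable M (entry_space n)"
    by (rule measurable_cong[THEN iffD1, OF _ *]) (simp add: mat_entries XC)
  show "random_matrix M n (\<lambda>\<omega>. Q * X \<omega>)"
    unfolding random_matrix_def
  proof (intro conjI ballI allI impI)
    fix i j assume ij: "i < n" "j < n"
    have "(\<lambda>\<omega>. entries n (Q * X \<omega>) (i,j)) \<in> borel_measurable M"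
      by (rule measurable_compose[OF m measurable_component_singleton]) (use ij in auto)
    then show "(\<lambda>\<omega>. (Q * X \<omega>) $$ (i,j)) \<in> borel_measurable M" using ij by (simp add: entries_def)
  qed (use XC Q in \<open>auto intro!: mult_carrier_mat[of _ n n]\<close>)
  show "matrix_law M n (\<lambda>\<omega>. Q * X \<omega>) = distr (matrix_law M n X) (entry_space n) (\<lambda>x. entries n (Q * mat n n x))"
    unfolding matrix_law_entries distr_distr[OF left_mult_measurable[OF Q] entries_measurable[OF X]]
    by (rule distr_cong) (simp_all add: mat_entries XC)
qed

lemma random_matrix_mult_right:
  assumes X: "random_matrix M n X" and Q: "Q \<in> carrier_mat n n"
  shows "random_matrix M n (\<lambda>\<omega>. X \<omega> * Q)"
    and "matrix_law M n (\<lambda>\<omega>. X \<omega> * Q) = distr (matrix_law M n X) (entry_space n) (\<lambda>x. entries n (mat n n x * Q))"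
proof -
  have XC: "\<And>\<omega>. \<omega> \<in> space M \<Longrightarrow> X \<omega> \<in> carrier_mat n n" using X by (simp add: random_matrix_def)
  have *: "(\<lambda>\<omega>. entries n (mat n n (entries n (X \<omega>)) * Q)) \<in> measurable M (entry_space n)"
    by (rule measurable_compose[OF entries_measurable[OF X] right_mult_measurable[OF Q]])
  have m: "(\<lambda>\<omega>. entries n (X \<omega> * Q)) \<in> measurable M (entry_space n)"
    by (rule measurable_cong[THEN iffD1, OF _ *]) (simp add: mat_entries XC)
  show "random_matrix M n (\<lambda>\<omega>. X \<omega> * Q)"
    unfolding random_matrix_def
  proof (intro conjI ballI allI impI)
    fix i j assume ij: "i < n" "j < n"
    have "(\<lambda>\<omega>. entries n (X \<omega> * Q) (i,j)) \<in> borel_measurable M"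
      by (rule measurable_compose[OF m measurable_component_singleton]) (use ij in auto)
    then show "(\<lambda>\<omega>. (X \<omega> * Q) $$ (i,j)) \<in> borel_measurable M" using ij by (simp add: entries_def)
  qed (use XC Q in \<open>auto intro!: mult_carrier_mat[of _ n n]\<close>)
  show "matrix_law M n (\<lambda>\<omega>. X \<omega> * Q) = distr (matrix_law M n X) (entry_space n) (\<lambda>x. entries n (mat n n x * Q))"
    unfolding matrix_law_entries distr_distr[OF right_mult_measurable[OF Q] entries_measurable[OF X]]
    by (rule distr_cong) (simp_all add: mat_entries XC)
qed

definition gaussian_density :: "nat \<Rightarrow> (nat \<times> nat \<Rightarrow> real) \<Rightarrow> ennreal" where
  "gaussian_density n x = (\<Prod>ij\<in>index_square n. ennreal (std_normal_density (x ij)))"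

lemma gaussian_density_measurable [measurable]:
  "gaussian_density n \<in> borel_measurable (entry_space n)"
  unfolding gaussian_density_def by measurable

lemma gaussian_matrix_law:
  assumes M: "prob_space M" and n: "0 < n" and B: "gaussian_matrix M n B"
  shows "matrix_law M n B = density (lebesgue_product (index_square n)) (gaussian_density n)"
proof -
  interpret prob_space M by (rule M)
  let ?I = "index_square n"
  have D: "distributed M lborel (\<lambda>\<omega>. B \<omega> $$ ij) std_normal_density" if "ij \<in> ?I" for ij
    using that B by (auto simp: gaussian_matrix_def)
  have ne: "?I \<noteq> {}" using n by auto
  have "matrix_law M n B = (\<Pi>\<^sub>M ij\<in>?I. distr M borel (\<lambda>\<omega>. B \<omega> $$ ij))"
    unfolding matrix_law_def
    by (rule indep_vars_iff_distr_eq_PiM'[OF ne, THEN iffD1])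
      (use B in \<open>auto simp: gaussian_matrix_def random_matrix_def\<close>)
  also have "\<dots> = (\<Pi>\<^sub>M ij\<in>?I. density lborel (\<lambda>t. ennreal (std_normal_density t)))"
  proof (rule PiM_cong[OF refl])
    fix ij assume "ij \<in> ?I"
    have "distr M borel (\<lambda>\<omega>. B \<omega> $$ ij) = distr M lborel (\<lambda>\<omega>. B \<omega> $$ ij)"
      by (rule distr_cong) simp_all
    then show "distr M borel (\<lambda>\<omega>. B \<omega> $$ ij) = density lborel (\<lambda>t. ennreal (std_normal_density t))"
      using distributed_distr_eq_density[OF D[OF \<open>ij \<in> ?I\<close>]] by simp
  qed
  also have "\<dots> = density (lebesgue_product ?I) (gaussian_density n)"
    unfolding gaussian_density_def
    by (rule density_PiM_product)
      (auto intro!: prob_space_imp_sigma_finite prob_space_normal_density)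
  finally show ?thesis .
qed

lemma gaussian_density_total:
  "(\<integral>\<^sup>+x. gaussian_density n x \<partial>lebesgue_product (index_square n)) = 1"
proof -
  interpret L: product_sigma_finite "\<lambda>_::nat \<times> nat. lborel :: real measure" ..
  have "(\<integral>\<^sup>+t. ennreal (std_normal_density t) \<partial>lborel) = 1"
    using prob_space.emeasure_space_1[OF prob_space_normal_density[of 1 0]] by (simp add: emeasure_density)
  then show ?thesis
    unfolding gaussian_density_def by (subst L.product_nn_integral_prod) simp_all
qed

lemma gaussian_density_eq:
  "gaussian_density n x = ennreal ((1 / sqrt (2 * pi)) ^ card (index_square n) * exp (- (\<Sum>ij\<in>index_square n. (x ij)\<^sup>2) / 2))"
proof -
  have "gaussian_density n x = ennreal (\<Prod>ij\<in>index_square n. 1 / sqrt (2 * pi) * exp (- (x ij)\<^sup>2 / 2))"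
    unfolding gaussian_density_def std_normal_density_def by (rule prod_ennreal) simp
  also have "(\<Prod>ij\<in>index_square n. 1 / sqrt (2 * pi) * exp (- (x ij)\<^sup>2 / 2)) =
      (1 / sqrt (2 * pi)) ^ card (index_square n) * exp (\<Sum>ij\<in>index_square n. - (x ij)\<^sup>2 / 2)"
    unfolding prod.distrib prod_constant by (subst exp_sum) simp_all
  finally show ?thesis by (simp add: sum_divide_distrib sum_negf)
qed

text \<open>The Frobenius norm is the sum of the squared column norms, and \<open>Q\<close> acts on the columns separately.\<close>

lemma sum_squares_orthogonal_mult:
  assumes Q: "Q \<in> orthogonal_group n" and X: "X \<in> carrier_mat n n"
  shows "(\<Sum>ij\<in>index_square n. ((Q * X) $$ ij)\<^sup>2) = (\<Sum>ij\<in>index_square n. (X $$ ij)\<^sup>2)"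
proof -
  have QC: "Q \<in> carrier_mat n n" by (rule orthogonal_groupD(1)[OF Q])
  have sum_cols: "(\<Sum>ij\<in>index_square n. (Z $$ ij)\<^sup>2) = (\<Sum>j<n. col Z j \<bullet> col Z j)" if Z: "Z \<in> carrier_mat n n" for Z :: "real mat"
  proof -
    have "(\<Sum>ij\<in>index_square n. (Z $$ ij)\<^sup>2) = (\<Sum>j<n. \<Sum>i<n. (Z $$ (i,j))\<^sup>2)"
      by (subst sum.swap) (simp add: sum.cartesian_product)
    also have "\<dots> = (\<Sum>j<n. col Z j \<bullet> col Z j)"
      using Z by (intro sum.cong refl) (simp add: sq_norm_sum[of _ n])
    finally show ?thesis .
  qed
  have "col (Q * X) j \<bullet> col (Q * X) j = col X j \<bullet> col X j" if "j < n" for j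
    using orthogonal_group_sq_norm[OF Q, of "col X j"] that X
    by (simp only: col_mult2[OF QC X that] col_carrier_vec[OF that X])
  then show ?thesis using X QC by (simp add: sum_cols)
qed

text \<open>The joint density depends on the Frobenius norm only, so \<open>X \<mapsto> Q X\<close> preserves it. Being even and of
integral 1, it also serves as the function \<open>g\<close> of \<open>lebesgue_product_linear_invariant\<close>, so
\<open>X \<mapsto> Q X\<close> preserves the reference measure as well.\<close>

lemma gaussian_matrix_law_orthogonal_invariant:
  assumes M: "prob_space M" and n: "0 < n" and B: "gaussian_matrix M n B" and Q: "Q \<in> orthogonal_group n"
  shows "matrix_law M n (\<lambda>\<omega>. Q * B \<omega>) = matrix_law M n B"
proof -
  let ?I = "index_square n" let ?L = "lebesgue_product ?I" let ?g = "gaussian_density n"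
  note Q' = orthogonal_groupD[OF Q]
  define T where "T x = entries n (Q * mat n n x)" for x
  have T [measurable]: "T \<in> measurable (entry_space n) (entry_space n)"
    unfolding T_def by (rule left_mult_measurable[OF Q'(1)])
  have gT: "?g (T x) = ?g x" for x
  proof -
    have "(\<Sum>ij\<in>?I. (T x ij)\<^sup>2) = (\<Sum>ij\<in>?I. ((Q * mat n n x) $$ ij)\<^sup>2)"
      by (intro sum.cong) (simp_all add: T_def entries_def)
    also have "\<dots> = (\<Sum>ij\<in>?I. (mat n n x $$ ij)\<^sup>2)"
      by (rule sum_squares_orthogonal_mult[OF Q]) simp
    also have "\<dots> = (\<Sum>ij\<in>?I. (x ij)\<^sup>2)" by (intro sum.cong) auto
    finally show ?thesis by (simp add: gaussian_density_eq)
  qed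
  have refl: "\<exists>y'. \<forall>x\<in>space ?L. T (\<lambda>i\<in>?I. y' i - x i) = (\<lambda>i\<in>?I. y i - T x i)" if "y \<in> space ?L" for y
  proof (rule exI, rule ballI)
    fix x
    let ?y' = "entries n (transpose_mat Q * mat n n y)"
    have "mat n n (\<lambda>i\<in>?I. ?y' i - x i) = transpose_mat Q * mat n n y - mat n n x"
      using Q'(1) by (auto simp: entries_def)
    then have "Q * mat n n (\<lambda>i\<in>?I. ?y' i - x i) = Q * (transpose_mat Q * mat n n y) - Q * mat n n x"
      using Q'(1) by (simp add: mult_minus_distrib_mat[of _ n n _ n])
    also have "Q * (transpose_mat Q * mat n n y) = mat n n y"
      using Q'(1,3) by (simp flip: assoc_mult_mat[of _ n n _ n _ n])
    finally have "Q * mat n n (\<lambda>i\<in>?I. ?y' i - x i) = mat n n y - Q * mat n n x" .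
    then show "T (\<lambda>i\<in>?I. ?y' i - x i) = (\<lambda>i\<in>?I. y i - T x i)"
      using Q'(1) unfolding T_def by (auto simp: entries_def fun_eq_iff simp del: index_mult_mat(1))
  qed
  note sets_lebesgue_product [measurable_cong]
  have "matrix_law M n (\<lambda>\<omega>. Q * B \<omega>) = distr (density ?L ?g) (entry_space n) T"
    using random_matrix_mult_left(2)[of M n B Q] B Q'(1) gaussian_matrix_law[OF M n B]
    by (simp add: gaussian_matrix_def T_def[abs_def])
  also have "\<dots> = density ?L ?g"
  proof (rule measure_eqI)
    fix A assume "A \<in> sets (distr (density ?L ?g) (entry_space n) T)"
    then have A [measurable]: "A \<in> sets (entry_space n)" by simp
    have T': "T \<in> measurable (density ?L ?g) (entry_space n)" by measurable
    have "emeasure (distr (density ?L ?g) (entry_space n) T) A = (\<integral>\<^sup>+z. indicator A z \<partial>distr (density ?L ?g) (entry_space n) T)"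
      by simp
    also have "\<dots> = (\<integral>\<^sup>+x. indicator A (T x) \<partial>density ?L ?g)"
      by (rule nn_integral_distr[OF T']) measurable
    also have "\<dots> = (\<integral>\<^sup>+x. ?g x * indicator A (T x) \<partial>?L)"
      by (rule nn_integral_density) measurable
    also have "\<dots> = (\<integral>\<^sup>+x. (\<lambda>z. ?g z * indicator A z) (T x) \<partial>?L)" by (simp add: gT)
    also have "\<dots> = (\<integral>\<^sup>+x. ?g x * indicator A x \<partial>?L)"
      by (rule lebesgue_product_linear_invariant[where g = ?g])
        (use gT gaussian_density_total refl in \<open>auto simp: gaussian_density_eq cong: sum.cong\<close>)
    also have "\<dots> = emeasure (density ?L ?g) A" by (rule emeasure_density[symmetric]) measurable
    finally show "emeasure (distr (density ?L ?g) (entry_space n) T) A = emeasure (density ?L ?g) A" .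
  qed (simp add: sets_lebesgue_product)
  also have "density ?L ?g = matrix_law M n B" by (rule gaussian_matrix_law[OF M n B, symmetric])
  finally show ?thesis .
qed

section \<open>Almost sure invertibility\<close>

lemma det_entries_measurable: "(\<lambda>x. det (mat n n x) :: real) \<in> borel_measurable (entry_space n)"
proof -
  have "(\<lambda>x. \<Sum>p\<in>{p. p permutes {0..<n}}. signof p * (\<Prod>i=0..<n. x (i, p i)) :: real) \<in> borel_measurable (entry_space n)"
  proof (intro borel_measurable_sum borel_measurable_times borel_measurable_prod borel_measurable_const)
    fix p i assume "p \<in> {p. p permutes {0..<n}}" "i \<in> {0..<n}"
    then show "(\<lambda>x. x (i, p i)) \<in> borel_measurable (entry_space n)"
      using permutes_in_image[of p "{0..<n}" i] by (intro measurable_component_singleton) auto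
  qed
  also have "(\<lambda>x. \<Sum>p\<in>{p. p permutes {0..<n}}. signof p * (\<Prod>i=0..<n. x (i, p i)) :: real) = (\<lambda>x. det (mat n n x))"
  proof (rule ext)
    fix x :: "nat \<times> nat \<Rightarrow> real"
    have "(\<Prod>i=0..<n. x (i, p i)) = (\<Prod>i=0..<n. mat n n x $$ (i, p i))" if "p permutes {0..<n}" for p
      using permutes_in_image[OF that] by (intro prod.cong) auto
    then show "(\<Sum>p\<in>{p. p permutes {0..<n}}. signof p * (\<Prod>i=0..<n. x (i, p i))) = (det (mat n n x) :: real)"
      by (simp add: det_def)
  qed
  finally show ?thesis .
qed

lemma finite_singular_shifts:
  fixes A :: "real mat"
  assumes A: "A \<in> carrier_mat n n"
  shows "finite {t. det (A + t \<cdot>\<^sub>m 1\<^sub>m n) = 0}"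
proof -
  have "char_poly A \<noteq> 0" using degree_monic_char_poly[OF A] by auto
  then have "finite {k. poly (char_poly A) k = 0}" by (rule poly_roots_finite)
  moreover have "{t. det (A + t \<cdot>\<^sub>m 1\<^sub>m n) = 0} \<subseteq> uminus ` {k. poly (char_poly A) k = 0}"
  proof
    fix t assume "t \<in> {t. det (A + t \<cdot>\<^sub>m 1\<^sub>m n) = 0}"
    then have "det (char_matrix A (- t)) = 0" using A by (simp add: char_matrix_def)
    then have "poly (char_poly A) (- t) = 0"
      using eigenvalue_det[OF A] eigenvalue_root_char_poly[OF A] by blast
    then show "t \<in> uminus ` {k. poly (char_poly A) k = 0}" by (intro image_eqI[of _ _ "- t"]) auto
  qed
  ultimately show ?thesis by (meson finite_imageI finite_subset)
qed

text \<open>Each line \<open>X + t I\<close> meets the singular matrices in finitely many points, as \<open>-t\<close> has to be an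
eigenvalue of \<open>X\<close>. Averaging the translation invariant Lebesgue measure over the shifts by \<open>t I\<close> with \<open>t\<close> in the
unit interval therefore shows that the set of singular matrices is null.\<close>

lemma AE_lebesgue_det_nonzero:
  "AE x in lebesgue_product (index_square n). det (mat n n x) \<noteq> 0"
proof -
  let ?I = "index_square n" let ?L = "lebesgue_product ?I"
  note sets_lebesgue_product [measurable_cong] and det_entries_measurable [measurable]
  interpret product_sigma_finite "\<lambda>_::nat \<times> nat. lborel :: real measure" ..
  interpret S: sigma_finite_measure ?L by (rule sigma_finite) simp
  interpret P: pair_sigma_finite ?L "lborel :: real measure" ..
  define Z where "Z x = (indicator {x. det (mat n n x) = (0::real)} x :: ennreal)" for x :: "nat \<times> nat \<Rightarrow> real"
  have Z [measurable]: "Z \<in> borel_measurable (entry_space n)"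
    unfolding Z_def[abs_def] by measurable
  \<comment> \<open>The factor 1 matches the form \<open>a i + c * x i\<close> of the affine maps above.\<close>
  define sh where "sh t x = (\<lambda>ij\<in>?I. (if fst ij = snd ij then t else 0) + 1 * x ij)" for t :: real and x :: "nat \<times> nat \<Rightarrow> real"
  have [measurable]: "(\<lambda>(x,t). sh t x) \<in> measurable (?L \<Otimes>\<^sub>M lborel) (entry_space n)"
    unfolding sh_def by measurable
  have sh_inv: "(\<integral>\<^sup>+x. Z (sh t x) \<partial>?L) = (\<integral>\<^sup>+x. Z x \<partial>?L)" for t
    unfolding sh_def by (rule nn_integral_lebesgue_product_affine) simp_all
  have null: "(\<integral>\<^sup>+t. indicator {0..1} t * Z (sh t x) \<partial>lborel) = 0" for x
  proof -
    have "mat n n (sh t x) = mat n n x + t \<cdot>\<^sub>m 1\<^sub>m n" for t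
      by (auto simp: sh_def)
    then have "finite {t. det (mat n n (sh t x)) = 0}"
      using finite_singular_shifts[of "mat n n x" n] by simp
    then have "AE t in lborel. t \<notin> {t. det (mat n n (sh t x)) = 0}"
      by (intro AE_not_in finite_imp_null_set_lborel)
    then have "AE t in lborel. indicator {0..1} t * Z (sh t x) = (0::ennreal)"
      by eventually_elim (simp add: Z_def)
    then have "(\<integral>\<^sup>+t. indicator {0..1} t * Z (sh t x) \<partial>lborel) = (\<integral>\<^sup>+(t::real). 0 \<partial>lborel)"
      by (rule nn_integral_cong_AE)
    then show ?thesis by simp
  qed
  have "(\<integral>\<^sup>+x. Z x \<partial>?L) = (\<integral>\<^sup>+t. indicator {0..1::real} t * (\<integral>\<^sup>+x. Z x \<partial>?L) \<partial>lborel)"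
    by (simp add: nn_integral_multc)
  also have "\<dots> = (\<integral>\<^sup>+t. (\<integral>\<^sup>+x. indicator {0..1} t * Z (sh t x) \<partial>?L) \<partial>lborel)"
  proof (rule nn_integral_cong)
    fix t :: real
    have [measurable]: "(\<lambda>x. sh t x) \<in> measurable ?L (entry_space n)" unfolding sh_def by measurable
    show "indicator {0..1::real} t * (\<integral>\<^sup>+x. Z x \<partial>?L) = (\<integral>\<^sup>+x. indicator {0..1} t * Z (sh t x) \<partial>?L)"
      by (simp add: nn_integral_cmult sh_inv)
  qed
  also have "\<dots> = (\<integral>\<^sup>+x. (\<integral>\<^sup>+t. indicator {0..1} t * Z (sh t x) \<partial>lborel) \<partial>?L)"
    by (rule P.Fubini') measurable
  also have "\<dots> = 0" by (simp add: null)
  finally have "(\<integral>\<^sup>+x. Z x \<partial>?L) = 0" .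
  then have "AE x in ?L. Z x = 0" by (subst (asm) nn_integral_0_iff_AE) measurable
  then show ?thesis by eventually_elim (simp add: Z_def indicator_def split: if_splits)
qed

lemma AE_gaussian_det_nonzero:
  assumes M: "prob_space M" and n: "0 < n" and B: "gaussian_matrix M n B"
  shows "AE \<omega> in M. det (B \<omega>) \<noteq> 0"
proof -
  note sets_lebesgue_product [measurable_cong] and det_entries_measurable [measurable]
  have RB: "random_matrix M n B" using B by (simp add: gaussian_matrix_def)
  have "AE x in lebesgue_product (index_square n). 0 < gaussian_density n x \<longrightarrow> det (mat n n x) \<noteq> 0"
    using AE_lebesgue_det_nonzero by eventually_elim simp
  then have "AE x in matrix_law M n B. det (mat n n x) \<noteq> 0"
    unfolding gaussian_matrix_law[OF M n B] by (subst AE_density) measurable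
  then have "AE \<omega> in M. det (mat n n (entries n (B \<omega>))) \<noteq> 0"
    unfolding matrix_law_entries by (subst (asm) AE_distr_iff[OF entries_measurable[OF RB]]) auto
  then show ?thesis
    using AE_space
  proof eventually_elim
    case (elim \<omega>)
    then show ?case using RB by (simp add: random_matrix_def mat_entries)
  qed
qed

section \<open>The orthogonal factor of a Gaussian matrix\<close>

definition normalized :: "nat \<Rightarrow> (nat \<Rightarrow> real) \<Rightarrow> nat \<Rightarrow> real" where
  "normalized n w i = w i / sqrt (\<Sum>l<n. (w l)\<^sup>2)"

text \<open>The classical Gram-Schmidt process as an explicit function of the entries of the matrix, column by
column: \<open>gram_schmidt_col n x j i\<close> is entry \<open>i\<close> of the \<open>j\<close>-th orthonormalised column. Explicit
formulas make it evidently measurable, also where it has no geometric meaning because a division by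
zero occurs.\<close>

function gram_schmidt_col :: "nat \<Rightarrow> (nat \<times> nat \<Rightarrow> real) \<Rightarrow> nat \<Rightarrow> nat \<Rightarrow> real" where
  "gram_schmidt_col n x j = normalized n
     (\<lambda>i. x (i,j) - (\<Sum>k<j. (\<Sum>l<n. gram_schmidt_col n x k l * x (l,j)) * gram_schmidt_col n x k i))"
  by auto
termination by (relation "Wellfounded.measure (\<lambda>(n,x,j). j)") auto

declare gram_schmidt_col.simps [simp del]

lemma gram_schmidt_col_measurable:
  "i < n \<Longrightarrow> j < n \<Longrightarrow> (\<lambda>x. gram_schmidt_col n x j i) \<in> borel_measurable (entry_space n)"
proof (induction j arbitrary: i rule: less_induct)
  case (less j)
  have comp: "(\<lambda>x. x (l,j)) \<in> borel_measurable (entry_space n)" if "l < n" for l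
    using that less.prems by (intro measurable_component_singleton) auto
  have w: "(\<lambda>x. x (i,j) - (\<Sum>k<j. (\<Sum>l<n. gram_schmidt_col n x k l * x (l,j)) * gram_schmidt_col n x k i))
      \<in> borel_measurable (entry_space n)" if "i < n" for i
    using that less.prems comp
    by (intro borel_measurable_diff borel_measurable_sum borel_measurable_times less.IH) auto
  show ?case
    unfolding gram_schmidt_col.simps[of n _ j] normalized_def
    using w less.prems
    by (intro borel_measurable_divide borel_measurable_sqrt borel_measurable_sum borel_measurable_power) auto
qed

text \<open>Uniqueness of the QR decomposition with positive diagonal: if \<open>v\<^sub>0, v\<^sub>1, \<dots>\<close> are the columns of
\<open>V\<close>, then column \<open>j\<close> of \<open>V T\<close> is the sum of \<open>T\<^sub>k\<^sub>j v\<^sub>k\<close> over \<open>k \<le> j\<close> and \<open>T\<^sub>k\<^sub>j\<close> is its scalar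
product with \<open>v\<^sub>k\<close>. Subtracting the components for \<open>k < j\<close> leaves \<open>T\<^sub>j\<^sub>j v\<^sub>j\<close>, which is normalised to
\<open>v\<^sub>j\<close>.\<close>

lemma gram_schmidt_col_of_qr:
  assumes V: "V \<in> orthogonal_group n" and T: "T \<in> carrier_mat n n" and ut: "upper_triangular T"
    and pos: "\<And>i. i < n \<Longrightarrow> 0 < T $$ (i,i)"
  shows "i < n \<Longrightarrow> j < n \<Longrightarrow> gram_schmidt_col n (entries n (V * T)) j i = V $$ (i,j)"
proof (induction j arbitrary: i rule: less_induct)
  case (less j)
  note V' = orthogonal_groupD[OF V]
  let ?x = "entries n (V * T)"
  have j: "j < n" by fact
  have T0: "T $$ (k,j) = 0" if "j < k" "k < n" for k
    using ut T that by (auto simp: upper_triangular_def)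
  have x: "?x (i,j) = (\<Sum>k<j. V $$ (i,k) * T $$ (k,j)) + V $$ (i,j) * T $$ (j,j)" if "i < n" for i
  proof -
    have "?x (i,j) = (\<Sum>k<n. V $$ (i,k) * T $$ (k,j))"
      using that j mult_index_sum[OF V'(1) T] by (simp add: entries_def)
    also have "\<dots> = (\<Sum>k<Suc j. V $$ (i,k) * T $$ (k,j))"
      using j T0 by (intro sum.mono_neutral_right) auto
    finally show ?thesis by simp
  qed
  have coeff: "(\<Sum>l<n. V $$ (l,k) * ?x (l,j)) = T $$ (k,j)" if "k < n" for k
  proof -
    have "(transpose_mat V * (V * T)) $$ (k,j) = (\<Sum>l<n. transpose_mat V $$ (k,l) * (V * T) $$ (l,j))"
      by (rule mult_index_sum) (use V'(1) T that j in auto)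
    also have "\<dots> = (\<Sum>l<n. V $$ (l,k) * ?x (l,j))"
      using V'(1) that j by (intro sum.cong refl) (simp add: entries_def)
    also have "transpose_mat V * (V * T) = T"
      using V' T by (simp flip: assoc_mult_mat[of _ n n _ n _ n])
    finally show ?thesis by simp
  qed
  have w: "?x (i,j) - (\<Sum>k<j. (\<Sum>l<n. gram_schmidt_col n ?x k l * ?x (l,j)) * gram_schmidt_col n ?x k i)
      = V $$ (i,j) * T $$ (j,j)" if "i < n" for i
  proof -
    have "(\<Sum>k<j. (\<Sum>l<n. gram_schmidt_col n ?x k l * ?x (l,j)) * gram_schmidt_col n ?x k i)
        = (\<Sum>k<j. V $$ (i,k) * T $$ (k,j))"
    proof (intro sum.cong refl)
      fix k assume "k \<in> {..<j}"
      then have k: "k < j" "k < n" using j by auto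
      then show "(\<Sum>l<n. gram_schmidt_col n ?x k l * ?x (l,j)) * gram_schmidt_col n ?x k i = V $$ (i,k) * T $$ (k,j)"
        using less.IH[OF k(1) _ k(2)] that coeff[OF k(2)] by simp
    qed
    then show ?thesis using x[OF that] by simp
  qed
  have "(\<Sum>l<n. (V $$ (l,j) * T $$ (j,j))\<^sup>2) = (T $$ (j,j))\<^sup>2 * (col V j \<bullet> col V j)"
    using V'(1) j by (simp add: sq_norm_sum[of _ n] power_mult_distrib sum_distrib_left mult.commute)
  also have "col V j \<bullet> col V j = 1"
    using gram_index[OF V'(1) j j] j unfolding V'(2) by simp
  finally have "sqrt (\<Sum>l<n. (V $$ (l,j) * T $$ (j,j))\<^sup>2) = T $$ (j,j)" using pos[OF j] by simp
  then show ?case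
    unfolding gram_schmidt_col.simps[of n _ j] normalized_def
    using w less.prems pos[OF j] by simp
qed

definition gram_schmidt_entries :: "nat \<Rightarrow> (nat \<times> nat \<Rightarrow> real) \<Rightarrow> nat \<times> nat \<Rightarrow> real" where
  "gram_schmidt_entries n x = (\<lambda>ij\<in>index_square n. gram_schmidt_col n x (snd ij) (fst ij))"

lemma gram_schmidt_entries_measurable:
  "gram_schmidt_entries n \<in> measurable (entry_space n) (entry_space n)"
  unfolding gram_schmidt_entries_def[abs_def]
  by (rule measurable_restrict) (auto intro!: gram_schmidt_col_measurable)

lemma gram_schmidt_entries_of_qr:
  assumes "V \<in> orthogonal_group n" "T \<in> carrier_mat n n" "upper_triangular T"
    "\<And>i. i < n \<Longrightarrow> 0 < T $$ (i,i)"
  shows "gram_schmidt_entries n (entries n (V * T)) = entries n V"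
  using gram_schmidt_col_of_qr[OF assms] by (auto simp: gram_schmidt_entries_def entries_def fun_eq_iff)

lemma qr_diagonal_pos:
  assumes qr: "qr_decomposition n B V T" and nn: "\<forall>i<n. 0 \<le> T $$ (i,i)" and det: "det B \<noteq> 0" and i: "i < n"
  shows "0 < T $$ (i,i)"
proof -
  have V: "V \<in> carrier_mat n n" and T: "T \<in> carrier_mat n n" and ut: "upper_triangular T" and B: "B = V * T"
    using qr by (auto simp: qr_decomposition_def orthogonal_group_def)
  have "det T \<noteq> 0" using det det_mult[OF V T] B by auto
  then have "0 \<notin> set (diag_mat T)" unfolding det_upper_triangular[OF ut T] by (simp add: prod_list_zero_iff)
  then have "T $$ (i,i) \<noteq> 0" using i T by (auto simp: diag_mat_def image_iff)
  then show ?thesis using nn i by (simp add: order_less_le)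
qed

text \<open>If \<open>B = V T\<close> is the normalised QR decomposition of \<open>B\<close>, then \<open>(P V) T\<close> is that of \<open>P B\<close>. So
\<open>P V\<close> is almost surely the same measurable function of \<open>P B\<close> for every orthogonal \<open>P\<close>, and the
invariance of the law of \<open>B\<close> passes to \<open>V\<close>.\<close>

lemma gaussian_qr_left_invariant:
  assumes M: "prob_space M" and n: "0 < n" and B: "gaussian_matrix M n B" and V: "random_matrix M n V"
    and qr: "\<And>\<omega>. \<omega> \<in> space M \<Longrightarrow> \<exists>T. qr_decomposition n (B \<omega>) (V \<omega>) T \<and> (\<forall>i<n. 0 \<le> T $$ (i,i))"
    and Q: "Q \<in> orthogonal_group n"
  shows "matrix_law M n (\<lambda>\<omega>. Q * V \<omega>) = matrix_law M n V"
proof -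
  note Q' = orthogonal_groupD[OF Q]
  have RB: "random_matrix M n B" using B by (simp add: gaussian_matrix_def)
  have law: "matrix_law M n (\<lambda>\<omega>. P * V \<omega>) =
      distr (matrix_law M n (\<lambda>\<omega>. P * B \<omega>)) (entry_space n) (gram_schmidt_entries n)"
    if P: "P \<in> orthogonal_group n" for P
  proof -
    note P' = orthogonal_groupD[OF P]
    have PV: "random_matrix M n (\<lambda>\<omega>. P * V \<omega>)" and PB: "random_matrix M n (\<lambda>\<omega>. P * B \<omega>)"
      using random_matrix_mult_left(1)[OF V P'(1)] random_matrix_mult_left(1)[OF RB P'(1)] .
    have "AE \<omega> in M. entries n (P * V \<omega>) = gram_schmidt_entries n (entries n (P * B \<omega>))"
      using AE_gaussian_det_nonzero[OF M n B] AE_space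
    proof eventually_elim
      case (elim \<omega>)
      obtain T where T: "qr_decomposition n (B \<omega>) (V \<omega>) T" "\<forall>i<n. 0 \<le> T $$ (i,i)"
        using qr[OF elim(2)] by blast
      have V\<omega>: "V \<omega> \<in> orthogonal_group n" and TC: "T \<in> carrier_mat n n" "upper_triangular T" and B\<omega>: "B \<omega> = V \<omega> * T"
        using T(1) by (auto simp: qr_decomposition_def)
      have "gram_schmidt_entries n (entries n ((P * V \<omega>) * T)) = entries n (P * V \<omega>)"
        by (rule gram_schmidt_entries_of_qr[OF orthogonal_group_mult[OF P V\<omega>] TC])
          (rule qr_diagonal_pos[OF T elim(1)])
      also have "(P * V \<omega>) * T = P * B \<omega>"
        unfolding B\<omega> by (rule assoc_mult_mat[OF P'(1) orthogonal_groupD(1)[OF V\<omega>] TC(1)])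
      finally show ?case by simp
    qed
    then have "matrix_law M n (\<lambda>\<omega>. P * V \<omega>) = distr M (entry_space n) (\<lambda>\<omega>. gram_schmidt_entries n (entries n (P * B \<omega>)))"
      unfolding matrix_law_entries
      by (intro distr_cong_AE entries_measurable[OF PV]
          measurable_compose[OF entries_measurable[OF PB] gram_schmidt_entries_measurable]) auto
    also have "\<dots> = distr (matrix_law M n (\<lambda>\<omega>. P * B \<omega>)) (entry_space n) (gram_schmidt_entries n)"
      unfolding matrix_law_entries
      by (subst distr_distr[OF gram_schmidt_entries_measurable entries_measurable[OF PB]]) (simp add: o_def)
    finally show ?thesis .
  qed
  have one: "matrix_law M n (\<lambda>\<omega>. 1\<^sub>m n * X \<omega>) = matrix_law M n X" if "random_matrix M n X" for X
    unfolding matrix_law_entries using that by (intro distr_cong) (auto simp: random_matrix_def)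
  have "1\<^sub>m n \<in> orthogonal_group n" by (simp add: orthogonal_group_def)
  from law[OF this] law[OF Q] show ?thesis
    unfolding gaussian_matrix_law_orthogonal_invariant[OF M n B Q] one[OF V] one[OF RB] by simp
qed

section \<open>Measurability of the smallest singular value\<close>

lemma mult_vec_sq_norm_sum:
  fixes N :: "real mat"
  assumes N: "N \<in> carrier_mat r r" and x: "x \<in> carrier_vec r"
  shows "(N *\<^sub>v x) \<bullet> (N *\<^sub>v x) = (\<Sum>i<r. (\<Sum>j<r. N $$ (i,j) * x $ j)\<^sup>2)"
proof -
  have "N *\<^sub>v x \<in> carrier_vec r" using N x by simp
  then have "(N *\<^sub>v x) \<bullet> (N *\<^sub>v x) = (\<Sum>i<r. ((N *\<^sub>v x) $ i)\<^sup>2)" by (rule sq_norm_sum)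
  also have "\<dots> = (\<Sum>i<r. (\<Sum>j<r. N $$ (i,j) * x $ j)\<^sup>2)"
    using N x by (intro sum.cong refl) (simp add: scalar_prod_def lessThan_atLeast0)
  finally show ?thesis .
qed

text \<open>Lists are used as a countable type that represents all integer vectors; entries beyond the length of
the list are unspecified integers, which does no harm.\<close>

definition int_vec :: "nat \<Rightarrow> int list \<Rightarrow> real vec" where
  "int_vec r l = vec r (\<lambda>i. real_of_int (l ! i))"

lemma int_vec_carrier [simp]: "int_vec r l \<in> carrier_vec r"
  by (simp add: int_vec_def)

lemma floor_scaled_tendsto:
  "(\<lambda>m. real_of_int \<lfloor>real (Suc m) * x\<rfloor> / real (Suc m)) \<longlonglongrightarrow> x"
proof (rule tendsto_sandwich)
  have l: "real (Suc m) * x - 1 \<le> real_of_int \<lfloor>real (Suc m) * x\<rfloor>" for m by linarith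
  have "x - inverse (real (Suc m)) = (real (Suc m) * x - 1) / real (Suc m)" for m
    by (simp add: field_simps)
  also have "\<dots> m \<le> real_of_int \<lfloor>real (Suc m) * x\<rfloor> / real (Suc m)" for m
    using l[of m] by (intro divide_right_mono) auto
  finally show "\<forall>\<^sub>F m in sequentially. x - inverse (real (Suc m)) \<le> real_of_int \<lfloor>real (Suc m) * x\<rfloor> / real (Suc m)"
    by simp
  have "real_of_int \<lfloor>real (Suc m) * x\<rfloor> / real (Suc m) \<le> real (Suc m) * x / real (Suc m)" for m
    by (intro divide_right_mono) auto
  then show "\<forall>\<^sub>F m in sequentially. real_of_int \<lfloor>real (Suc m) * x\<rfloor> / real (Suc m) \<le> x" by simp
  show "(\<lambda>m. x - inverse (real (Suc m))) \<longlonglongrightarrow> x"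
    using tendsto_diff[OF tendsto_const LIMSEQ_inverse_real_of_nat, of x] by simp
qed simp

text \<open>Both sides are homogeneous of degree 2 and continuous in \<open>x\<close>, so it suffices to test rational, and
hence integer, vectors. Countably many tests make \<open>sigma_min\<close> measurable.\<close>

lemma bounded_below_on_int_vecs:
  assumes N: "N \<in> carrier_mat r r"
    and int: "\<And>l. a\<^sup>2 * (int_vec r l \<bullet> int_vec r l) \<le> (N *\<^sub>v int_vec r l) \<bullet> (N *\<^sub>v int_vec r l)"
    and x: "x \<in> carrier_vec r"
  shows "a\<^sup>2 * (x \<bullet> x) \<le> (N *\<^sub>v x) \<bullet> (N *\<^sub>v x)"
proof -
  define y where "y m j = real_of_int \<lfloor>real (Suc m) * x $ j\<rfloor> / real (Suc m)" for m j
  define q where "q z = (\<Sum>i<r. (\<Sum>j<r. N $$ (i,j) * z j)\<^sup>2) - a\<^sup>2 * (\<Sum>j<r. (z j)\<^sup>2)" for z :: "nat \<Rightarrow> real"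
  have q_vec: "q (\<lambda>j. z $ j) = (N *\<^sub>v z) \<bullet> (N *\<^sub>v z) - a\<^sup>2 * (z \<bullet> z)" if "z \<in> carrier_vec r" for z
    using that by (simp add: q_def mult_vec_sq_norm_sum[OF N that] sq_norm_sum[OF that])
  have pos: "0 \<le> q (y m)" for m
  proof -
    define l where "l = map (\<lambda>j. \<lfloor>real (Suc m) * x $ j\<rfloor>) [0..<r]"
    have "q (y m) = q (\<lambda>j. int_vec r l $ j) / (real (Suc m))\<^sup>2"
      by (simp add: q_def y_def int_vec_def l_def power_divide diff_divide_distrib flip: sum_divide_distrib)
    also have "\<dots> \<ge> 0" using int[of l] by (simp add: q_vec)
    finally show ?thesis .
  qed
  have "(\<lambda>m. q (y m)) \<longlonglongrightarrow> q (\<lambda>j. x $ j)"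
    unfolding q_def y_def
    by (intro tendsto_diff tendsto_sum tendsto_power tendsto_mult tendsto_const floor_scaled_tendsto)
  then have "0 \<le> q (\<lambda>j. x $ j)" by (rule LIMSEQ_le_const) (use pos in auto)
  then show ?thesis using q_vec[OF x] by simp
qed

lemma sigma_min_measurable:
  assumes N: "random_matrix M r N" and r: "0 < r"
  shows "(\<lambda>\<omega>. sigma_min (N \<omega>)) \<in> borel_measurable M"
  unfolding borel_measurable_iff_ge
proof
  fix a :: real
  have NC: "N \<omega> \<in> carrier_mat r r" if "\<omega> \<in> space M" for \<omega> using N that by (simp add: random_matrix_def)
  have [measurable]: "(\<lambda>\<omega>. N \<omega> $$ (i,j)) \<in> borel_measurable M" if "i < r" "j < r" for i j
    using N that by (simp add: random_matrix_def)
  show "{\<omega> \<in> space M. a \<le> sigma_min (N \<omega>)} \<in> sets M"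
  proof (cases "a \<le> 0")
    case True
    then have "{\<omega> \<in> space M. a \<le> sigma_min (N \<omega>)} = space M"
      using sigma_min_nonneg[OF NC r] by (auto intro: order_trans)
    then show ?thesis by simp
  next
    case False
    have "{\<omega> \<in> space M. a \<le> sigma_min (N \<omega>)} =
        {\<omega> \<in> space M. \<forall>l. a\<^sup>2 * (int_vec r l \<bullet> int_vec r l) \<le> (\<Sum>i<r. (\<Sum>j<r. N \<omega> $$ (i,j) * int_vec r l $ j)\<^sup>2)}"
    proof (rule Collect_cong, rule conj_cong[OF refl])
      fix \<omega> assume \<omega>: "\<omega> \<in> space M"
      have "a \<le> sigma_min (N \<omega>) \<longleftrightarrow>
          (\<forall>x\<in>carrier_vec r. a\<^sup>2 * (x \<bullet> x) \<le> (N \<omega> *\<^sub>v x) \<bullet> (N \<omega> *\<^sub>v x))"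
        using False by (intro le_sigma_min_iff[OF NC[OF \<omega>] r]) simp
      also have "\<dots> \<longleftrightarrow> (\<forall>l. a\<^sup>2 * (int_vec r l \<bullet> int_vec r l) \<le> (N \<omega> *\<^sub>v int_vec r l) \<bullet> (N \<omega> *\<^sub>v int_vec r l))"
        using bounded_below_on_int_vecs[OF NC[OF \<omega>]] int_vec_carrier by blast
      finally show "a \<le> sigma_min (N \<omega>) \<longleftrightarrow>
          (\<forall>l. a\<^sup>2 * (int_vec r l \<bullet> int_vec r l) \<le> (\<Sum>i<r. (\<Sum>j<r. N \<omega> $$ (i,j) * int_vec r l $ j)\<^sup>2))"
        by (simp add: mult_vec_sq_norm_sum[OF NC[OF \<omega>]])
    qed
    also have "\<dots> \<in> sets M"
      by (rule sets.sets_Collect_countable_All) measurable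
    finally show ?thesis .
  qed
qed

section \<open>Both estimates with a common Haar matrix\<close>

text \<open>Right multiplication by the fixed matrix \<open>P\<close> commutes with all left translations, so the left
invariance of the law of \<open>V\<close> is inherited by \<open>V P\<close>.\<close>

lemma haar_orthogonal_gaussian_qr_mult_right:
  assumes M: "prob_space M" and n: "0 < n" and B: "gaussian_matrix M n B" and V: "random_matrix M n V"
    and qr: "\<And>\<omega>. \<omega> \<in> space M \<Longrightarrow> \<exists>T. qr_decomposition n (B \<omega>) (V \<omega>) T \<and> (\<forall>i<n. 0 \<le> T $$ (i,i))"
    and P: "P \<in> orthogonal_group n"
  shows "haar_orthogonal M n (\<lambda>\<omega>. V \<omega> * P)"
  unfolding haar_orthogonal_def
proof (intro conjI ballI)
  have VO: "V \<omega> \<in> orthogonal_group n" if "\<omega> \<in> space M" for \<omega>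
    using qr[OF that] by (auto simp: qr_decomposition_def)
  have PC: "P \<in> carrier_mat n n" by (rule orthogonal_groupD(1)[OF P])
  show "random_matrix M n (\<lambda>\<omega>. V \<omega> * P)" by (rule random_matrix_mult_right(1)[OF V PC])
  show "V \<omega> * P \<in> orthogonal_group n" if "\<omega> \<in> space M" for \<omega>
    by (rule orthogonal_group_mult[OF VO[OF that] P])
  fix Q assume Q: "Q \<in> orthogonal_group n"
  have QC: "Q \<in> carrier_mat n n" by (rule orthogonal_groupD(1)[OF Q])
  have QV: "random_matrix M n (\<lambda>\<omega>. Q * V \<omega>)" by (rule random_matrix_mult_left(1)[OF V QC])
  have inv: "matrix_law M n (\<lambda>\<omega>. Q * V \<omega>) = matrix_law M n V"
    by (rule gaussian_qr_left_invariant[OF M n B V qr Q])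
  have "matrix_law M n (\<lambda>\<omega>. Q * (V \<omega> * P)) = matrix_law M n (\<lambda>\<omega>. (Q * V \<omega>) * P)"
    unfolding matrix_law_entries
    using assoc_mult_mat[OF QC orthogonal_groupD(1)[OF VO] PC] by (intro distr_cong) auto
  also have "\<dots> = matrix_law M n (\<lambda>\<omega>. V \<omega> * P)"
    unfolding random_matrix_mult_right(2)[OF QV PC] random_matrix_mult_right(2)[OF V PC]
      inv by (rule refl)
  finally show "matrix_law M n (\<lambda>\<omega>. Q * (V \<omega> * P)) = matrix_law M n (\<lambda>\<omega>. V \<omega> * P)" .
qed

theorem theorem5p2:
  fixes M :: "'w measure"
    and A :: "real mat"
    and B U R V :: "'w \<Rightarrow> real mat"
    and n r :: nat
  assumes "prob_space M"
    and "A \<in> carrier_mat n n"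
    and "1 \<le> r" and "r < n"
    and "rurv M n A B U R V"
  shows "\<exists>(f :: 'w \<Rightarrow> real) X I J.
     f \<in> borel_measurable M \<and>
     haar_orthogonal M n X \<and>
     I \<subseteq> {..<n} \<and> card I = r \<and> J \<subseteq> {..<n} \<and> card J = r \<and>
     (\<forall>\<omega>\<in>space M. f \<omega> = sigma_min (submatrix (X \<omega>) I J)) \<and>
     (\<forall>\<omega>\<in>space M.
        (f \<omega> * sing_val A r \<le> sigma_min (submatrix (R \<omega>) {..<r} {..<r}) \<and>
         sigma_min (submatrix (R \<omega>) {..<r} {..<r})
           \<le> sqrt ((sing_val A r)\<^sup>2 + (sing_val A (r + 1))\<^sup>2) \<and>
         sqrt ((sing_val A r)\<^sup>2 + (sing_val A (r + 1))\<^sup>2) \<le> sqrt 2 * sing_val A r) \<and>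
        (sing_val A (r + 1) < f \<omega> * sing_val A r \<longrightarrow>
           sing_val A (r + 1) \<le> sigma_max (submatrix (R \<omega>) {r..<n} {r..<n}) \<and>
           sigma_max (submatrix (R \<omega>) {r..<n} {r..<n})
             \<le> 3 * sing_val A (r + 1) *
                (f \<omega> powi (-4) * (sing_val A 1 / sing_val A r) ^ 3 /
                 (1 - (sing_val A (r + 1))\<^sup>2 / ((f \<omega>)\<^sup>2 * (sing_val A r)\<^sup>2)))))"
proof -
  have n: "0 < n" and r0: "0 < r" using \<open>1 \<le> r\<close> \<open>r < n\<close> by auto
  have B: "gaussian_matrix M n B" and V: "random_matrix M n V"
    and qrB: "\<And>\<omega>. \<omega> \<in> space M \<Longrightarrow> \<exists>T. qr_decomposition n (B \<omega>) (V \<omega>) T \<and> (\<forall>i<n. 0 \<le> T $$ (i, i))"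
    and qrA: "\<And>\<omega>. \<omega> \<in> space M \<Longrightarrow> qr_decomposition n (A * transpose_mat (V \<omega>)) (U \<omega>) (R \<omega>)"
    using \<open>rurv M n A B U R V\<close> by (auto simp: rurv_def)
  have VO: "V \<omega> \<in> orthogonal_group n" if "\<omega> \<in> space M" for \<omega>
    using qrB[OF that] by (auto simp: qr_decomposition_def)
  obtain Q where Q: "Q \<in> orthogonal_group n" and
    "\<And>z. z \<in> carrier_vec n \<Longrightarrow>
       (A *\<^sub>v (Q *\<^sub>v z)) \<bullet> (A *\<^sub>v (Q *\<^sub>v z)) = (\<Sum>i<n. (singular_values A ! i)\<^sup>2 * (z $ i)\<^sup>2)"
    by (rule singular_values_right_basis[OF \<open>A \<in> carrier_mat n n\<close>]) blast
  then have basis: "\<forall>z\<in>carrier_vec n.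
       (A *\<^sub>v (Q *\<^sub>v z)) \<bullet> (A *\<^sub>v (Q *\<^sub>v z)) = (\<Sum>i<n. (singular_values A ! i)\<^sup>2 * (z $ i)\<^sup>2)"
    by blast
  define X where "X \<omega> = V \<omega> * Q" for \<omega>
  define f where "f \<omega> = sigma_min (submatrix (X \<omega>) {..<r} {..<r})" for \<omega>
  have haar: "haar_orthogonal M n X"
    unfolding X_def[abs_def]
    by (rule haar_orthogonal_gaussian_qr_mult_right[OF \<open>prob_space M\<close> n B V qrB Q])
  have X: "random_matrix M n X" and XC: "\<And>\<omega>. \<omega> \<in> space M \<Longrightarrow> X \<omega> \<in> carrier_mat n n"
    using haar by (auto simp: haar_orthogonal_def random_matrix_def)
  have "random_matrix M r (\<lambda>\<omega>. block (X \<omega>) 0 r 0 r)"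
    using X \<open>r < n\<close> by (auto simp: random_matrix_def block_def)
  then have "(\<lambda>\<omega>. sigma_min (block (X \<omega>) 0 r 0 r)) \<in> borel_measurable M"
    by (rule sigma_min_measurable[OF _ r0])
  then have f: "f \<in> borel_measurable M"
    by (rule measurable_cong[THEN iffD1, rotated])
      (use submatrix_leading[OF XC less_imp_le[OF \<open>r < n\<close>]] in \<open>simp add: f_def\<close>)
  let ?s = "sing_val A r" and ?t = "sing_val A (r + 1)"
  have t: "0 \<le> ?t" "?t \<le> ?s" "?s \<le> sing_val A 1"
    using singular_values_nonneg[OF \<open>A \<in> carrier_mat n n\<close>] singular_values_antimono[OF \<open>A \<in> carrier_mat n n\<close>]
      \<open>1 \<le> r\<close> \<open>r < n\<close> by (simp_all add: sing_val_def)
  have bounds: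
    "(f \<omega> * ?s \<le> sigma_min (submatrix (R \<omega>) {..<r} {..<r}) \<and>
      sigma_min (submatrix (R \<omega>) {..<r} {..<r}) \<le> sqrt (?s\<^sup>2 + ?t\<^sup>2) \<and>
      sqrt (?s\<^sup>2 + ?t\<^sup>2) \<le> sqrt 2 * ?s) \<and>
     (?t < f \<omega> * ?s \<longrightarrow>
      ?t \<le> sigma_max (submatrix (R \<omega>) {r..<n} {r..<n}) \<and>
      sigma_max (submatrix (R \<omega>) {r..<n} {r..<n})
        \<le> 3 * ?t * (f \<omega> powi (-4) * (sing_val A 1 / ?s) ^ 3 / (1 - ?t\<^sup>2 / ((f \<omega>)\<^sup>2 * ?s\<^sup>2))))"
    if "\<omega> \<in> space M" for \<omega>
  proof -
    note b = rurv_singular_value_bounds[OF \<open>A \<in> carrier_mat n n\<close> \<open>1 \<le> r\<close> \<open>r < n\<close> VO[OF that] qrA[OF that] Q basis,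
        folded X_def, folded f_def]
    have "?s \<le> sqrt (?s\<^sup>2 + ?t\<^sup>2)" by (rule real_le_rsqrt) simp
    with b(2) have 1: "sigma_min (submatrix (R \<omega>) {..<r} {..<r}) \<le> sqrt (?s\<^sup>2 + ?t\<^sup>2)" by linarith
    have "?t\<^sup>2 \<le> ?s\<^sup>2" using t by (intro power_mono)
    then have "sqrt (?s\<^sup>2 + ?t\<^sup>2) \<le> sqrt (2 * ?s\<^sup>2)" by simp
    also have "\<dots> = sqrt 2 * ?s" using t by (simp add: real_sqrt_mult)
    finally have 2: "sqrt (?s\<^sup>2 + ?t\<^sup>2) \<le> sqrt 2 * ?s" .
    have 3: "sigma_max (submatrix (R \<omega>) {r..<n} {r..<n})
        \<le> 3 * ?t * (f \<omega> powi (-4) * (sing_val A 1 / ?s) ^ 3 / (1 - ?t\<^sup>2 / ((f \<omega>)\<^sup>2 * ?s\<^sup>2)))"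
      if gap: "?t < f \<omega> * ?s"
    proof -
      have "0 < f \<omega> * ?s" using gap t by linarith
      then have pos: "0 < f \<omega>" "0 < ?s" using b(6) t by (auto simp: zero_less_mult_iff)
      show ?thesis
        using b(4)[OF pos(1)] crude_factor_bound[OF pos(1) b(5) pos(2) t(3) t(1) gap] by linarith
    qed
    show ?thesis using b(1,3) 1 2 3 by blast
  qed
  show ?thesis
    by (rule exI[of _ f], rule exI[of _ X], rule exI[of _ "{..<r}"], rule exI[of _ "{..<r}"])
      (use f haar bounds \<open>r < n\<close> in \<open>auto simp: f_def\<close>)
qed

end
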